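(* Let $\varrho:\mathbb{R}_+\to\mathbb{R}_+$ be a Lipschitz kernel with $\int_0^\infty\varrho\,da=1$, $\int_0^\infty(1+a)^2\varrho(a)\,da<\infty$, $\partial_a\varrho\le0$, and $-\partial_a\varrho(a)/\varrho(a)\le\zeta$ for all $a>0$ for some constant $\zeta>0$. Let the past datum $X_p:(-\infty,0)\to\mathbb{R}^m$ be Lipschitz. Let $C(t)$, $t\ge0$, be the moving closed convex set in $\mathbb{R}^m$, with time discretization $C^n:=C(nh)$, $n\in\mathbb{N}$, for the step $h>0$. Assume that there is $M>0$ such that $C^n\subset B(0,M)$ for all $n\in\mathbb{N}$, and that for all $h<h_0$, with $N=\lfloor T/h\rfloor$, $$\sum_{n=1}^N \frac{d_H(C^n,C^{n-1})^2}{h}\le C_0<\infty,$$ where $C_0$ is uniform with respect to $h$. Let $(X^n)$ be the discrete delayed sweeping sequence, $X_h$ its piecewise linear interpolant and $\overline X_h$ the piecewise constant interpolant of the discrete averages, as defined in the context. Assume the uniform estimate $\|X_h\|_{H^1(0,T)}\le C$ for all $h>0$, for any finite $T>0$. Then, as $h\to0$, there exist $X\in H^1([0,T];\mathbb{R}^m)$ and a subsequence such that $X_h\to X$ in $C^0(0,T;\mathbb{R}^m)$, and the discrete averages converge, $\overline X_h\to\overline X$ in $L^p(0,T;\mathbb{R}^m)$ for $1\le p<\infty$, where $$\overline X(t):=\int_0^\infty\varrho(s)\,X(t-s)\,ds .$$ Moreover, the limit function $X$ satisfies $$\overline X(t)-X(t)\in N_{C(t)}(X(t))\quad\text{for a.e.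 }t\in(0,T),$$ equivalently, $X(t)=P_{C(t)}(\overline X(t))$ for a.e. $t\in(0,T)$.
   Context: For simplicity $T/h$ is taken to be an integer $N$. The discrete kernel is $R_j:=\frac1h\int_{jh}^{(j+1)h}\varrho(a)\,da$ for $j\ge0$. The discrete delayed sweeping sequence is defined by $X^n:=X_p(nh)$ for $n<0$ and, for $n\in\{0,\dots,N\}$, $$X^n:=P_{C^n}(\overline X^n),\qquad \overline X^n:=\frac{h\sum_{j\ge1}X^{n-j}R_j}{h\sum_{j\ge1}R_j},$$ where $P_K$ is the Euclidean projection onto the (nonempty) closed convex set $K$. $X_h$ is the piecewise linear function on $[0,T]$ with $X_h(nh)=X^n$, $0\le n\le N$; $\overline X_h(t):=\overline X^n$ for $t\in(nh,(n+1)h]$. In the formula for $\overline X(t)$, $X(t):=X_p(t)$ for $t<0$. $d_H$ is the Hausdorff distance and $N_K(x)=\{v:\langle v,y-x\rangle\le0\ \forall y\in K\}$ is the normal cone of convex analysis at $x\in K$.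
   Formalization: The moving set C(t) is additionally assumed continuous in time for the Hausdorff distance; without this the claim fails, e.g. m=1, X_p=0, C(t)={min(t,T)} if t/T is rational and C(t)={0} otherwise. *)

theory Defs
  imports "HOL-Analysis.Analysis"
begin

section \<open>Lebesgue and Sobolev spaces on subsets of the real line\<close>

definition in_Lp :: "real \<Rightarrow> real set \<Rightarrow> (real \<Rightarrow> 'a::euclidean_space) \<Rightarrow> bool" where
  "in_Lp p S f \<longleftrightarrow> set_borel_measurable lborel S f
     \<and> set_integrable lborel S (\<lambda>t. norm (f t) powr p)"

definition Lp_norm :: "real \<Rightarrow> real set \<Rightarrow> (real \<Rightarrow> 'a::euclidean_space) \<Rightarrow> real" where
  "Lp_norm p S f = (LINT t:S|lborel. norm (f t) powr p) powr (1 / p)"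

definition Lp_convergent ::
  "real \<Rightarrow> real set \<Rightarrow> (nat \<Rightarrow> real \<Rightarrow> 'a::euclidean_space) \<Rightarrow> (real \<Rightarrow> 'a) \<Rightarrow> bool" where
  "Lp_convergent p S F f \<longleftrightarrow> (\<forall>k. in_Lp p S (F k)) \<and> in_Lp p S f
     \<and> (\<lambda>k. Lp_norm p S (\<lambda>t. F k t - f t)) \<longlonglongrightarrow> 0"

definition C1_test_function :: "real \<Rightarrow> real \<Rightarrow> (real \<Rightarrow> real) \<Rightarrow> (real \<Rightarrow> real) \<Rightarrow> bool" where
  "C1_test_function a b \<phi> \<phi>' \<longleftrightarrow>
     (\<forall>t. (\<phi> has_real_derivative \<phi>' t) (at t)) \<and> continuous_on UNIV \<phi>'
     \<and> (\<exists>c d. a < c \<and> d < b \<and> (\<forall>t. t \<notin> {c..d} \<longrightarrow> \<phi> t = 0))"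

text \<open>Square-integrable weak derivatives on the open interval $(a,b)$, tested as usual in one
  dimension against compactly supported $C^1$ functions. They are unique up to null sets, so the
  choice made in \<open>weak_deriv\<close> does not affect \<open>H1_norm\<close>.\<close>

definition has_weak_deriv ::
  "real \<Rightarrow> real \<Rightarrow> (real \<Rightarrow> 'a::euclidean_space) \<Rightarrow> (real \<Rightarrow> 'a) \<Rightarrow> bool" where
  "has_weak_deriv a b u g \<longleftrightarrow> in_Lp 2 {a<..<b} g
     \<and> (\<forall>\<phi> \<phi>'. C1_test_function a b \<phi> \<phi>' \<longrightarrow>
          (LINT t:{a<..<b}|lborel. \<phi>' t *\<^sub>R u t) = - (LINT t:{a<..<b}|lborel. \<phi> t *\<^sub>R g t))"

definition in_H1 :: "real \<Rightarrow> real \<Rightarrow> (real \<Rightarrow> 'a::euclidean_space) \<Rightarrow> bool" where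
  "in_H1 a b u \<longleftrightarrow> in_Lp 2 {a<..<b} u \<and> (\<exists>g. has_weak_deriv a b u g)"

definition weak_deriv :: "real \<Rightarrow> real \<Rightarrow> (real \<Rightarrow> 'a::euclidean_space) \<Rightarrow> real \<Rightarrow> 'a" where
  "weak_deriv a b u = (SOME g. has_weak_deriv a b u g)"

definition H1_norm :: "real \<Rightarrow> real \<Rightarrow> (real \<Rightarrow> 'a::euclidean_space) \<Rightarrow> real" where
  "H1_norm a b u = sqrt ((LINT t:{a<..<b}|lborel. (norm (u t))\<^sup>2)
     + (LINT t:{a<..<b}|lborel. (norm (weak_deriv a b u t))\<^sup>2))"

section \<open>Convex sets and the Hausdorff distance\<close>

text \<open>As a real number this is meaningful for nonempty bounded sets only.\<close>

definition hausdorff_dist :: "'a::metric_space set \<Rightarrow> 'a set \<Rightarrow> real" where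
  "hausdorff_dist A B = max (SUP x\<in>A. infdist x B) (SUP y\<in>B. infdist y A)"

text \<open>Continuity in time of a moving set. It has to be required separately: bounds on the variation
  of \<open>C\<close> along the grids $nh$ with $T/h$ an integer only see the values of \<open>C\<close> on a countable set
  of times.\<close>

definition hausdorff_continuous_on :: "real set \<Rightarrow> (real \<Rightarrow> 'a::metric_space set) \<Rightarrow> bool" where
  "hausdorff_continuous_on S C \<longleftrightarrow>
     (\<forall>t\<in>S. ((\<lambda>s. hausdorff_dist (C s) (C t)) \<longlongrightarrow> 0) (at t within S))"

text \<open>Empty at points outside \<open>K\<close>.\<close>

definition normal_cone :: "'a::real_inner set \<Rightarrow> 'a \<Rightarrow> 'a set" where
  "normal_cone K x = {v. x \<in> K \<and> (\<forall>y\<in>K. v \<bullet> (y - x) \<le> 0)}"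

section \<open>Delayed kernels\<close>

text \<open>A Lipschitz kernel is differentiable almost everywhere only; the bounds on its derivative
  are required at every point where it is differentiable. They force \<open>\<rho>\<close> to be
  positive: a zero of \<open>\<rho>\<close> in $(0,\infty)$ is excluded by the last condition (off the zero set,
  $\rho(a) \ge \rho(0) e^{-\zeta a}$) and the normalization.\<close>

definition admissible_kernel :: "(real \<Rightarrow> real) \<Rightarrow> real \<Rightarrow> bool" where
  "admissible_kernel \<rho> \<zeta> \<longleftrightarrow>
     (\<forall>a\<ge>0. 0 \<le> \<rho> a)
     \<and> (\<exists>L. L-lipschitz_on {0..} \<rho>)
     \<and> (LINT a:{0..}|lborel. \<rho> a) = 1
     \<and> set_integrable lborel {0..} (\<lambda>a. (1 + a)\<^sup>2 * \<rho> a)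
     \<and> (\<forall>a>0. \<forall>D. (\<rho> has_real_derivative D) (at a) \<longrightarrow> D \<le> 0 \<and> - D / \<rho> a \<le> \<zeta>)"

definition discrete_kernel :: "(real \<Rightarrow> real) \<Rightarrow> real \<Rightarrow> nat \<Rightarrow> real" where
  "discrete_kernel \<rho> h j = (1 / h) * (LINT a:{real j * h..real (j + 1) * h}|lborel. \<rho> a)"

section \<open>The discrete delayed sweeping sequence and its interpolants\<close>

text \<open>The sum over $j \ge 1$ is indexed by $j = i + 1$ with $i$ a natural number.\<close>

definition discrete_average ::
  "(real \<Rightarrow> real) \<Rightarrow> real \<Rightarrow> (int \<Rightarrow> 'a::euclidean_space) \<Rightarrow> int \<Rightarrow> 'a" where
  "discrete_average \<rho> h x n =
     (h *\<^sub>R (\<Sum>i. discrete_kernel \<rho> h (i + 1) *\<^sub>R x (n - int (i + 1))))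
       /\<^sub>R (h * (\<Sum>i. discrete_kernel \<rho> h (i + 1)))"

text \<open>The body of \<open>discrete_average\<close> is written out in the recursion; lemma
  \<open>sweeping_eq_closest_point\<close> recovers the folded form.\<close>

function sweeping_seq ::
  "(real \<Rightarrow> real) \<Rightarrow> (real \<Rightarrow> 'a::euclidean_space set) \<Rightarrow> (real \<Rightarrow> 'a) \<Rightarrow> real \<Rightarrow> int \<Rightarrow> 'a" where
  "sweeping_seq \<rho> C Xp h n =
     (if n < 0 then Xp (of_int n * h)
      else closest_point (C (of_int n * h))
        ((h *\<^sub>R (\<Sum>i. discrete_kernel \<rho> h (i + 1) *\<^sub>R sweeping_seq \<rho> C Xp h (n - int (i + 1))))
           /\<^sub>R (h * (\<Sum>i. discrete_kernel \<rho> h (i + 1)))))"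
  by pat_completeness auto
termination
  by (relation "Wellfounded.measure (\<lambda>(\<rho>, C, Xp, h, n). nat (n + 1))") auto

declare sweeping_seq.simps [simp del]

lemma sweeping_eq_past: "n < 0 \<Longrightarrow> sweeping_seq \<rho> C Xp h n = Xp (of_int n * h)"
  by (simp add: sweeping_seq.simps)

lemma sweeping_eq_closest_point:
  "0 \<le> n \<Longrightarrow> sweeping_seq \<rho> C Xp h n
     = closest_point (C (of_int n * h)) (discrete_average \<rho> h (sweeping_seq \<rho> C Xp h) n)"
  by (subst sweeping_seq.simps) (simp add: discrete_average_def)

definition linear_interpolant :: "real \<Rightarrow> (int \<Rightarrow> 'a::real_vector) \<Rightarrow> real \<Rightarrow> 'a" where
  "linear_interpolant h x t =
     (let n = \<lfloor>t / h\<rfloor> in x n + (t / h - of_int n) *\<^sub>R (x (n + 1) - x n))"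

text \<open>The value at index $n$ is taken on $(nh, (n+1)h]$.\<close>

definition step_interpolant :: "real \<Rightarrow> (int \<Rightarrow> 'a) \<Rightarrow> real \<Rightarrow> 'a" where
  "step_interpolant h x t = x (\<lceil>t / h\<rceil> - 1)"

definition delayed_average ::
  "(real \<Rightarrow> real) \<Rightarrow> (real \<Rightarrow> 'a::euclidean_space) \<Rightarrow> (real \<Rightarrow> 'a) \<Rightarrow> real \<Rightarrow> 'a" where
  "delayed_average \<rho> Xp X t =
     (LINT s:{0..}|lborel. \<rho> s *\<^sub>R (if t - s < 0 then Xp (t - s) else X (t - s)))"

text \<open>Steps for which the final time is a grid point.\<close>

definition admissible_step :: "real \<Rightarrow> real \<Rightarrow> bool" where
  "admissible_step T h \<longleftrightarrow> 0 < h \<and> T / h \<in> \<nat>"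

end

theory Submission
  imports Defs "HOL-Complex_Analysis.Great_Picard"
begin

text \<open>The $H^1$ bound makes the interpolants $X_h$ uniformly Hoelder continuous of exponent $1/2$, so
  Arzela--Ascoli gives a uniformly convergent subsequence; the limit is in $H^1$ because weak
  derivatives are stable under $L^2$ convergence of nearly minimal derivatives of approximants.
  The discrete average is, up to normalization by \<open>\<integral>\<^sub>h\<^sup>\<infinity> \<rho>\<close>, the integral over $a \ge h$ of
  $\varrho(a)\,X^{n - \lfloor a/h \rfloor}$. It converges at every $t \in (0,T)$
  by dominated convergence in the age variable, a dominating function being the first moment of the
  kernel (the past datum grows at most linearly). Finally, the variational inequality characterizing
  the projection passes to the limit, since a point of $C(t)$ is approximated by its projections on
  $C^n$ when $nh \to t$.\<close>

section \<open>Square-integrable functions\<close>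

text \<open>\<open>H1_norm\<close> is computed from a weak derivative picked by choice, so the
  assumed bound says nothing about increments of X_h until that derivative is known to exist and to
  integrate to those increments. The slope of the interpolant gives existence; compactly supported
  cutoffs show that any two weak derivatives have the same integral over every subinterval, and
  Cauchy-Schwarz then gives the Hoelder modulus. The uniform sup bound that compactness also
  requires comes from the ball containing the sets. At time 0 the past datum and the limit may
  disagree, so values at grid times tending to 0 need not have a common limit. This touches only the
  age a = t, a null set in the averaging integral, which is why grid convergence is stated for s
  \<noteq> 0. Passing to the limit at fixed t uses Hausdorff continuity of the moving set, because
  the discrete projections are onto C at grid times near t.\<close>

lemma norm_diff_sq_le:
  fixes x y :: "'a::real_normed_vector"
  shows "(norm (x - y))\<^sup>2 \<le> 2 * (norm x)\<^sup>2 + 2 * (norm y)\<^sup>2"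
proof -
  have "(norm (x - y))\<^sup>2 \<le> (norm x + norm y)\<^sup>2"
    by (intro power_mono norm_triangle_ineq4) auto
  also have "\<dots> \<le> 2 * (norm x)\<^sup>2 + 2 * (norm y)\<^sup>2"
    using zero_le_power2[of "norm x - norm y"] by (simp add: power2_eq_square algebra_simps)
  finally show ?thesis .
qed

lemma integrable_norm_diff_sq:
  fixes f g :: "'a \<Rightarrow> 'b::{real_normed_vector, second_countable_topology}"
  assumes [measurable]: "f \<in> borel_measurable M" "g \<in> borel_measurable M"
    and "integrable M (\<lambda>t. (norm (f t))\<^sup>2)" "integrable M (\<lambda>t. (norm (g t))\<^sup>2)"
  shows "integrable M (\<lambda>t. (norm (f t - g t))\<^sup>2)"
proof (rule Bochner_Integration.integrable_bound)
  show "integrable M (\<lambda>t. 2 * (norm (f t))\<^sup>2 + 2 * (norm (g t))\<^sup>2)"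
    using assms(3,4) by auto
  show "AE x in M. norm ((norm (f x - g x))\<^sup>2) \<le> norm (2 * (norm (f x))\<^sup>2 + 2 * (norm (g x))\<^sup>2)"
    by (intro AE_I2) (use norm_diff_sq_le in auto)
qed measurable

lemma (in finite_measure) square_integrable_imp_integrable:
  fixes f :: "'a \<Rightarrow> 'b::{banach, second_countable_topology}"
  assumes "f \<in> borel_measurable M" and "integrable M (\<lambda>t. (norm (f t))\<^sup>2)"
  shows "integrable M f"
proof (rule Bochner_Integration.integrable_bound[where f = "\<lambda>t. 1 + (norm (f t))\<^sup>2"])
  have "r \<le> 1 + r\<^sup>2" for r :: real
    using zero_le_power2[of "r - 1/2"] zero_le_power2[of r]
    by (simp add: power2_eq_square algebra_simps)
  then show "AE x in M. norm (f x) \<le> norm (1 + (norm (f x))\<^sup>2)"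
    by (intro AE_I2) (smt (verit) real_norm_def zero_le_power2)
qed (use assms in auto)

text \<open>Cauchy-Schwarz against the constant 1, read off from the nonnegative quadratic l
  \<mapsto> \<open>LINT t|M. (norm (f t) - l)\<^sup>2\<close>. Its minimizer c / m exists only for
  positive total mass, hence the case split.\<close>

lemma (in finite_measure) norm_integral_sq_le:
  fixes f :: "'a \<Rightarrow> 'b::{banach, second_countable_topology}"
  assumes "f \<in> borel_measurable M" and int: "integrable M (\<lambda>t. (norm (f t))\<^sup>2)"
  shows "(norm (integral\<^sup>L M f))\<^sup>2 \<le> measure M (space M) * (LINT t|M. (norm (f t))\<^sup>2)"
proof -
  define c where "c = (LINT t|M. norm (f t))"
  define m where "m = measure M (space M)"
  define Q where "Q = (LINT t|M. (norm (f t))\<^sup>2)"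
  have i: "integrable M (\<lambda>t. norm (f t))"
    using square_integrable_imp_integrable[OF assms] by simp
  have q: "0 \<le> Q - 2 * l * c + l\<^sup>2 * m" for l
  proof -
    have "0 \<le> (LINT t|M. (norm (f t) - l)\<^sup>2)" by simp
    also have "\<dots> = (LINT t|M. (norm (f t))\<^sup>2 - 2 * l * norm (f t) + l\<^sup>2)"
      by (simp add: power2_diff algebra_simps)
    also have "\<dots> = Q - 2 * l * c + l\<^sup>2 * m"
      using i int by (simp add: Q_def c_def m_def)
    finally show ?thesis .
  qed
  have "c\<^sup>2 \<le> m * Q"
  proof (cases "m = 0")
    case True
    have "c = 0"
    proof (rule ccontr)
      assume "c \<noteq> 0"
      \<comment> \<open>For m = 0 the quadratic is the affine function Q - 2lc; at this l it takes
        the value -1.\<close>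
      with q[of "(Q + 1) / (2 * c)"] True show False by simp
    qed
    with True show ?thesis by simp
  next
    case False
    then have m: "m > 0" by (simp add: m_def zero_less_measure_iff)
    have "0 \<le> m * (Q - 2 * (c / m) * c + (c / m)\<^sup>2 * m)"
      using q[of "c / m"] m by simp
    also have "\<dots> = m * Q - c\<^sup>2"
      using m by (simp add: field_simps power2_eq_square)
    finally show ?thesis by simp
  qed
  moreover have "(norm (integral\<^sup>L M f))\<^sup>2 \<le> c\<^sup>2"
    unfolding c_def by (intro power_mono) (auto)
  ultimately show ?thesis by (simp add: m_def Q_def)
qed

text \<open>Riesz-Fischer: a rapidly Cauchy subsequence converges almost everywhere, and Fatou's
  lemma along it turns the Cauchy property into convergence in norm of the whole sequence.\<close>

lemma L2_complete:
  fixes f :: "nat \<Rightarrow> 'a \<Rightarrow> 'b::{banach, second_countable_topology}"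
  assumes meas [measurable]: "\<And>n. f n \<in> borel_measurable M"
    and int: "\<And>n. integrable M (\<lambda>t. (norm (f n t))\<^sup>2)"
    and Cauchy: "\<And>e. 0 < e \<Longrightarrow> \<exists>N. \<forall>m\<ge>N. \<forall>n\<ge>N. (LINT t|M. (norm (f m t - f n t))\<^sup>2) < e"
  obtains g where "g \<in> borel_measurable M" "integrable M (\<lambda>t. (norm (g t))\<^sup>2)"
    "(\<lambda>n. LINT t|M. (norm (f n t - g t))\<^sup>2) \<longlonglongrightarrow> 0"
proof -
  have int2: "integrable M (\<lambda>t. (norm (f m t - f n t))\<^sup>2)" for m n
    by (intro integrable_norm_diff_sq meas int)
  have nn: "(\<integral>\<^sup>+t. ennreal ((norm (f m t - f n t))\<^sup>2) \<partial>M) = ennreal (LINT t|M. (norm (f m t - f n t))\<^sup>2)" for m n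
    by (intro nn_integral_eq_integral int2) auto
  have "\<forall>j. \<exists>N. \<forall>m\<ge>N. \<forall>n\<ge>N. (LINT t|M. (norm (f m t - f n t))\<^sup>2) < (1/16)^j"
    by (intro allI Cauchy) simp
  then obtain N where N: "\<And>j m n. m \<ge> N j \<Longrightarrow> n \<ge> N j \<Longrightarrow> (LINT t|M. (norm (f m t - f n t))\<^sup>2) < (1/16)^j"
    by metis
  \<comment> \<open>The partial sums put both \<open>r j\<close> and \<open>r (Suc j)\<close> beyond
    \<open>N j\<close>; the summand \<open>j\<close> makes the indices tend to infinity.\<close>
  define r where "r j = j + (\<Sum>i\<le>j. N i)" for j
  have rN: "N j \<le> r j" "N j \<le> r (Suc j)" "j \<le> r j" for j
    unfolding r_def using member_le_sum[of j "{..j}" N] by auto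
  \<comment> \<open>The rate 16^(-j) is spent twice: weighting the squared increments by 4^j still
    leaves integrals summable like 4^(-j), and a finite weighted sum c at a point bounds the j-th
    increment there by sqrt c * 2^(-j), so the increments are summable.\<close>
  have sm: "summable (\<lambda>j. (1/4)^j :: real)" by (intro summable_geometric) auto
  have "(\<integral>\<^sup>+t. (\<Sum>j. ennreal (4^j * (norm (f (r (Suc j)) t - f (r j) t))\<^sup>2)) \<partial>M)
      = (\<Sum>j. \<integral>\<^sup>+t. ennreal (4^j * (norm (f (r (Suc j)) t - f (r j) t))\<^sup>2) \<partial>M)"
    by (intro nn_integral_suminf) measurable
  also have "\<dots> \<le> (\<Sum>j. ennreal ((1/4)^j))"
  proof (intro suminf_le allI)
    fix j
    have "(\<integral>\<^sup>+t. ennreal (4^j * (norm (f (r (Suc j)) t - f (r j) t))\<^sup>2) \<partial>M)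
        = ennreal (4^j) * ennreal (LINT t|M. (norm (f (r (Suc j)) t - f (r j) t))\<^sup>2)"
      by (simp add: ennreal_mult nn_integral_cmult nn)
    also have "\<dots> \<le> ennreal (4^j) * ennreal ((1/16)^j)"
      by (intro mult_left_mono ennreal_leI less_imp_le N rN) auto
    also have "\<dots> = ennreal ((1/4)^j)"
      by (simp add: ennreal_mult[symmetric] power_mult_distrib[symmetric])
    finally show "(\<integral>\<^sup>+t. ennreal (4^j * (norm (f (r (Suc j)) t - f (r j) t))\<^sup>2) \<partial>M) \<le> ennreal ((1/4)^j)" .
  qed auto
  also have "\<dots> < \<infinity>"
    using sm by (subst suminf_ennreal2) auto
  finally have fin': "(\<integral>\<^sup>+t. (\<Sum>j. ennreal (4^j * (norm (f (r (Suc j)) t - f (r j) t))\<^sup>2)) \<partial>M) \<noteq> \<infinity>"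
    by (simp only: less_top infinity_ennreal_def)
  have fin: "AE t in M. (\<Sum>j. ennreal (4^j * (norm (f (r (Suc j)) t - f (r j) t))\<^sup>2)) \<noteq> \<infinity>"
    by (rule nn_integral_noteq_infinite[OF _ fin']) measurable
  have conv: "AE t in M. convergent (\<lambda>j. f (r j) t)"
    using fin
  proof eventually_elim
    case (elim t)
    define v where "v j = f (r (Suc j)) t - f (r j) t" for j
    have "\<exists>c\<ge>0. s = ennreal c" if "s \<noteq> \<infinity>" for s :: ennreal
      using that by (cases s) auto
    then obtain c where c: "c \<ge> 0" "(\<Sum>j. ennreal (4^j * (norm (v j))\<^sup>2)) = ennreal c"
      using elim unfolding v_def by blast
    have vle: "norm (v j) \<le> sqrt c * (1/2)^j" for j
    proof -
      have "ennreal (4^j * (norm (v j))\<^sup>2) \<le> ennreal c"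
        using sum_le_suminf[of "\<lambda>j. ennreal (4^j * (norm (v j))\<^sup>2)" "{j}"] c by auto
      then have "4^j * (norm (v j))\<^sup>2 \<le> c" using c by simp
      then have "sqrt (4^j * (norm (v j))\<^sup>2) \<le> sqrt c" by simp
      then have "2^j * norm (v j) \<le> sqrt c"
        by (simp add: real_sqrt_mult real_sqrt_power)
      then show ?thesis by (simp add: field_simps)
    qed
    have "summable (\<lambda>j. sqrt c * (1/2)^j)"
      by (intro summable_mult summable_geometric) simp
    then have "summable v"
      by (rule summable_comparison_test') (rule vle)
    then have "convergent (\<lambda>n. f (r 0) t + (\<Sum>j<n. v j))"
      unfolding summable_iff_convergent by (intro convergent_add convergent_const)
    moreover have "f (r 0) t + (\<Sum>j<n. v j) = f (r n) t" for n
      unfolding v_def by (subst sum_lessThan_telescope) simp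
    ultimately show ?case by simp
  qed
  define g where "g t = lim (\<lambda>j. f (r j) t)" for t
  have [measurable]: "g \<in> borel_measurable M" unfolding g_def by measurable
  have lim: "AE t in M. (\<lambda>j. f (r j) t) \<longlonglongrightarrow> g t"
    using conv by eventually_elim (simp add: g_def convergent_LIMSEQ_iff)
  \<comment> \<open>Fatou in the subsequence index, with the other index \<open>n\<close> held
    fixed.\<close>
  have le: "(\<integral>\<^sup>+t. ennreal ((norm (f n t - g t))\<^sup>2) \<partial>M) \<le> ennreal e"
    if e: "\<forall>m\<ge>N. \<forall>n\<ge>N. (LINT t|M. (norm (f m t - f n t))\<^sup>2) < e" and n: "n \<ge> N" for N n e
  proof -
    have "(\<integral>\<^sup>+t. ennreal ((norm (f n t - g t))\<^sup>2) \<partial>M)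
        = (\<integral>\<^sup>+t. liminf (\<lambda>j. ennreal ((norm (f n t - f (r j) t))\<^sup>2)) \<partial>M)"
    proof (intro nn_integral_cong_AE)
      show "AE t in M. ennreal ((norm (f n t - g t))\<^sup>2) = liminf (\<lambda>j. ennreal ((norm (f n t - f (r j) t))\<^sup>2))"
        using lim
      proof eventually_elim
        case (elim t)
        have "(\<lambda>j. ennreal ((norm (f n t - f (r j) t))\<^sup>2)) \<longlonglongrightarrow> ennreal ((norm (f n t - g t))\<^sup>2)"
          by (intro tendsto_ennrealI tendsto_intros elim)
        then show ?case by (metis lim_imp_Liminf sequentially_bot)
      qed
    qed
    also have "\<dots> \<le> liminf (\<lambda>j. \<integral>\<^sup>+t. ennreal ((norm (f n t - f (r j) t))\<^sup>2) \<partial>M)"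
      by (intro nn_integral_liminf) measurable
    also have "\<dots> \<le> ennreal e"
    proof (rule Liminf_le)
      show "\<forall>\<^sub>F j in sequentially. (\<integral>\<^sup>+t. ennreal ((norm (f n t - f (r j) t))\<^sup>2) \<partial>M) \<le> ennreal e"
        unfolding nn
        using eventually_ge_at_top[of N]
      proof eventually_elim
        case (elim j)
        then have "r j \<ge> N" using rN(3)[of j] by linarith
        then show ?case using e n by (intro ennreal_leI) (simp add: less_imp_le)
      qed
    qed simp
    finally show ?thesis .
  qed
  \<comment> \<open>The tail bound with tolerance 1 gives integrability only for n beyond
    \<open>N 0\<close>. That suffices: \<open>g\<close> is then the difference of
    \<open>f (N 0)\<close> and \<open>f (N 0) - g\<close>.\<close>
  have ig: "integrable M (\<lambda>t. (norm (f n t - g t))\<^sup>2)" if "n \<ge> N 0" for n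
  proof (rule integrableI_bounded)
    have "(\<integral>\<^sup>+t. ennreal (norm ((norm (f n t - g t))\<^sup>2)) \<partial>M) \<le> ennreal 1"
      using le[of "N 0" 1 n] N[of 0] that by simp
    then show "(\<integral>\<^sup>+t. ennreal (norm ((norm (f n t - g t))\<^sup>2)) \<partial>M) < \<infinity>"
      by (simp add: order_le_less_trans)
  qed measurable
  show ?thesis
  proof
    show "integrable M (\<lambda>t. (norm (g t))\<^sup>2)"
      using integrable_norm_diff_sq[OF _ _ int ig, of "N 0" "N 0"] by simp
    show "(\<lambda>n. LINT t|M. (norm (f n t - g t))\<^sup>2) \<longlonglongrightarrow> 0"
    proof (rule LIMSEQ_I)
      fix e :: real assume e: "0 < e"
      obtain n0 where n0: "\<forall>m\<ge>n0. \<forall>n\<ge>n0. (LINT t|M. (norm (f m t - f n t))\<^sup>2) < e/2"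
        using Cauchy[of "e/2"] e by auto
      show "\<exists>no. \<forall>n\<ge>no. norm ((LINT t|M. (norm (f n t - g t))\<^sup>2) - 0) < e"
      proof (intro exI allI impI)
        fix n assume n: "n \<ge> max n0 (N 0)"
        have "ennreal (LINT t|M. (norm (f n t - g t))\<^sup>2) \<le> ennreal (e/2)"
          using le[OF n0, of n] n ig[of n] by (subst nn_integral_eq_integral[symmetric]) auto
        then have "(LINT t|M. (norm (f n t - g t))\<^sup>2) \<le> e/2"
          using e by (simp add: ennreal_le_iff)
        then show "norm ((LINT t|M. (norm (f n t - g t))\<^sup>2) - 0) < e"
          using e by simp
      qed
    qed
  qed fact
qed

text \<open>Nearly minimal elements of a decreasing sequence of midpoint convex sets are Cauchy by the
  parallelogram law; this replaces weak compactness of bounded sets of $L^2$.\<close>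

lemma L2_nested_convex:
  fixes S :: "nat \<Rightarrow> ('a \<Rightarrow> 'b::euclidean_space) set"
  assumes meas: "\<And>n f. f \<in> S n \<Longrightarrow> f \<in> borel_measurable M"
    and int: "\<And>n f. f \<in> S n \<Longrightarrow> integrable M (\<lambda>t. (norm (f t))\<^sup>2)"
    and dec: "\<And>m n. m \<le> n \<Longrightarrow> S n \<subseteq> S m"
    and mid: "\<And>n f g. f \<in> S n \<Longrightarrow> g \<in> S n \<Longrightarrow> (\<lambda>t. (1/2) *\<^sub>R (f t + g t)) \<in> S n"
    and bdd: "\<And>n. \<exists>f\<in>S n. (LINT t|M. (norm (f t))\<^sup>2) \<le> K"
  shows "\<exists>f g. (\<forall>n. f n \<in> S n) \<and> g \<in> borel_measurable M \<and> integrable M (\<lambda>t. (norm (g t))\<^sup>2)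
    \<and> (\<lambda>n. LINT t|M. (norm (f n t - g t))\<^sup>2) \<longlonglongrightarrow> 0"
proof -
  define Q where "Q f = (LINT t|M. (norm (f t))\<^sup>2)" for f :: "'a \<Rightarrow> 'b"
  define d where "d n = Inf (Q ` S n)" for n
  have below: "bdd_below (Q ` S n)" for n
    by (rule bdd_belowI[of _ 0]) (auto simp: Q_def)
  have dle: "d n \<le> Q f" if "f \<in> S n" for n f
    unfolding d_def by (intro cInf_lower below) (use that in auto)
  have dK: "d n \<le> K" for n
    using bdd[of n] dle[of _ n] unfolding Q_def by fastforce
  \<comment> \<open>Shrinking sets have growing infima, and \<open>K\<close> bounds them all, so the
    infima converge; their Cauchy property drives the whole argument.\<close>
  have dinc: "d m \<le> d n" if "m \<le> n" for m n
    unfolding d_def using bdd[of n] dec[OF that]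
    by (intro cInf_superset_mono below) auto
  then obtain L where "d \<longlonglongrightarrow> L"
    using incseq_convergent[of d K] dK dinc unfolding incseq_def by metis
  then have Cd: "Cauchy d" by (rule LIMSEQ_imp_Cauchy)
  have "\<exists>f\<in>S n. Q f < d n + 1 / real (Suc n)" for n
  proof -
    have "Q ` S n \<noteq> {}" using bdd[of n] by auto
    then obtain q where "q \<in> Q ` S n" "q < d n + 1 / real (Suc n)"
      using cInf_lessD[of "Q ` S n" "d n + 1 / real (Suc n)"] unfolding d_def by auto
    then show ?thesis by auto
  qed
  then obtain f where f: "\<And>n. f n \<in> S n" "\<And>n. Q (f n) < d n + 1 / real (Suc n)" by metis
  \<comment> \<open>Parallelogram law. The sum is written as a difference with
    \<open>- f n t\<close> so that the integrability of squared differences applies to it.\<close>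
  have par: "Q (\<lambda>t. f m t - f n t) = 2 * Q (f m) + 2 * Q (f n) - 4 * Q (\<lambda>t. (1/2) *\<^sub>R (f m t + f n t))" for m n
  proof -
    note [measurable] = meas[OF f(1)]
    have i: "integrable M (\<lambda>t. (norm (f m t - - f n t))\<^sup>2)"
      by (intro integrable_norm_diff_sq) (use int[OF f(1)] in auto)
    have "Q (\<lambda>t. f m t - f n t) = (LINT t|M. 2 * (norm (f m t))\<^sup>2 + 2 * (norm (f n t))\<^sup>2 - (norm (f m t - - f n t))\<^sup>2)"
      unfolding Q_def
      by (intro Bochner_Integration.integral_cong)
         (auto simp: power2_norm_eq_inner inner_simps inner_commute)
    also have "\<dots> = 2 * Q (f m) + 2 * Q (f n) - (LINT t|M. (norm (f m t - - f n t))\<^sup>2)"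
      using i int[OF f(1)] by (simp add: Q_def)
    also have "(LINT t|M. (norm (f m t - - f n t))\<^sup>2) = 4 * Q (\<lambda>t. (1/2) *\<^sub>R (f m t + f n t))"
      unfolding Q_def by (simp add: power_divide)
    finally show ?thesis .
  qed
  have C: "\<exists>N. \<forall>m\<ge>N. \<forall>n\<ge>N. (LINT t|M. (norm (f m t - f n t))\<^sup>2) < e" if "0 < e" for e
  proof -
    obtain N1 where N1: "\<And>m n. m \<ge> N1 \<Longrightarrow> n \<ge> N1 \<Longrightarrow> dist (d m) (d n) < e/8"
      using Cd \<open>0 < e\<close> unfolding Cauchy_def by (metis zero_less_divide_iff zero_less_numeral)
    obtain N2 where N2: "1 / real (Suc N2) < e/8"
      using \<open>0 < e\<close> nat_approx_posE[of "e/8"] by auto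
    define N where "N = max N1 N2"
    show ?thesis
    proof (intro exI[of _ N] allI impI)
      fix m n assume mn: "N \<le> m" "N \<le> n"
      have S: "f m \<in> S N" "f n \<in> S N" using f(1) dec mn by blast+
      have low: "4 * Q (\<lambda>t. (1/2) *\<^sub>R (f m t + f n t)) \<ge> 4 * d N"
        using dle[OF mid[OF S]] by simp
      \<comment> \<open>One e/8 pays for the gap between \<open>d k\<close> and \<open>d N\<close>,
        the other for near-minimality. In the parallelogram law the two upper bounds give 4
        \<open>d N\<close> + e, and the midpoint, lying in \<open>S N\<close>, removes 4
        \<open>d N\<close>.\<close>
      have Qk: "Q (f k) < d N + e/8 + e/8" if "N \<le> k" for k
      proof -
        have "1 / real (Suc k) \<le> 1 / real (Suc N2)"
          using that by (intro divide_left_mono) (auto simp: N_def)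
        moreover have "\<bar>d k - d N\<bar> < e/8"
          using N1[of k N] that unfolding N_def dist_real_def by auto
        ultimately show ?thesis
          using f(2)[of k] N2 by linarith
      qed
      have "Q (\<lambda>t. f m t - f n t) < e"
        unfolding par using low Qk[OF mn(1)] Qk[OF mn(2)] by linarith
      then show "(LINT t|M. (norm (f m t - f n t))\<^sup>2) < e" by (simp add: Q_def)
    qed
  qed
  show ?thesis
  proof (rule L2_complete[of f M])
    show "\<exists>f g. (\<forall>n. f n \<in> S n) \<and> g \<in> borel_measurable M \<and> integrable M (\<lambda>t. (norm (g t))\<^sup>2)
        \<and> (\<lambda>n. LINT t|M. (norm (f n t - g t))\<^sup>2) \<longlonglongrightarrow> 0"
      if "g \<in> borel_measurable M" "integrable M (\<lambda>t. (norm (g t))\<^sup>2)"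
        "(\<lambda>n. LINT t|M. (norm (f n t - g t))\<^sup>2) \<longlonglongrightarrow> 0" for g
      using that f(1) by (intro exI[of _ f] exI[of _ g] conjI allI)
  qed (use meas[OF f(1)] int[OF f(1)] C in auto)
qed

lemma emeasure_interval_finite: "emeasure lborel {a<..<b::real} < \<infinity>"
  by (cases "a \<le> b") auto

text \<open>Dominated convergence with the constant (2G)^p, integrable because the interval has
  finite length. The limit inherits measurability and the bound G, so membership in L^p comes along;
  applied to a constant sequence, the lemma yields membership of a single bounded function.\<close>

lemma Lp_convergent_bounded:
  fixes F :: "nat \<Rightarrow> real \<Rightarrow> 'a::euclidean_space"
  assumes p: "1 \<le> p" and F: "\<And>k. set_borel_measurable lborel {a<..<b} (F k)"
    and G: "\<And>k t. t \<in> {a<..<b} \<Longrightarrow> norm (F k t) \<le> G"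
    and lim: "\<And>t. t \<in> {a<..<b} \<Longrightarrow> (\<lambda>k. F k t) \<longlonglongrightarrow> f t"
  shows "Lp_convergent p {a<..<b} F f"
proof -
  let ?I = "{a<..<b}"
  have limI: "(\<lambda>k. indicator ?I t *\<^sub>R F k t) \<longlonglongrightarrow> indicator ?I t *\<^sub>R f t" for t
    using lim[of t] by (cases "t \<in> ?I") auto
  have f: "set_borel_measurable lborel ?I f"
    unfolding set_borel_measurable_def
    by (rule borel_measurable_LIMSEQ_metric[where f = "\<lambda>k t. indicator ?I t *\<^sub>R F k t"])
      (use F limI in \<open>auto simp: set_borel_measurable_def\<close>)
  have fG: "norm (f t) \<le> G" if "t \<in> ?I" for t
    by (rule tendsto_upperbound[OF tendsto_norm[OF lim[OF that]]]) (use G[OF that] in auto)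
  have const: "set_integrable lborel ?I (\<lambda>_. c :: real)" for c
    using emeasure_interval_finite[of a b] by (simp add: set_integrable_def integrable_indicator_iff)
  have powr: "set_borel_measurable lborel ?I (\<lambda>t. norm (g t) powr p)" if "set_borel_measurable lborel ?I g" for g :: "real \<Rightarrow> 'a"
  proof -
    have "(\<lambda>t. norm (indicator ?I t *\<^sub>R g t) powr p) \<in> borel_measurable lborel"
      using that unfolding set_borel_measurable_def by measurable
    also have "(\<lambda>t. norm (indicator ?I t *\<^sub>R g t) powr p) = (\<lambda>t. indicator ?I t *\<^sub>R (norm (g t) powr p))"
      using p by (auto simp: indicator_def)
    finally show ?thesis unfolding set_borel_measurable_def .
  qed
  have Lp: "in_Lp p ?I g" if g: "set_borel_measurable lborel ?I g" "\<And>t. t \<in> ?I \<Longrightarrow> norm (g t) \<le> G" for g :: "real \<Rightarrow> 'a"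
    unfolding in_Lp_def
  proof
    show "set_integrable lborel ?I (\<lambda>t. norm (g t) powr p)"
      by (rule set_integrable_bound[OF const[of "G powr p"] powr[OF g(1)]])
        (use p g(2) in \<open>auto intro!: AE_I2 powr_mono2\<close>)
  qed fact
  have diff: "set_borel_measurable lborel ?I (\<lambda>t. F k t - f t)" for k
    using F[of k] f unfolding set_borel_measurable_def scaleR_diff_right by measurable
  have "(\<lambda>k. LINT t:?I|lborel. norm (F k t - f t) powr p) \<longlonglongrightarrow> (LINT t::real|lborel. 0)"
    unfolding set_lebesgue_integral_def
  proof (rule integral_dominated_convergence[where w = "\<lambda>t. indicator ?I t *\<^sub>R ((G + G) powr p)"])
    show "AE t in lborel. (\<lambda>k. indicator ?I t *\<^sub>R norm (F k t - f t) powr p) \<longlonglongrightarrow> 0"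
    proof (rule AE_I2)
      fix t
      have "(\<lambda>k. norm (F k t - f t) powr p) \<longlonglongrightarrow> 0" if "t \<in> ?I"
        by (rule tendsto_zero_powrI[where b = p])
          (use p lim[OF that] in \<open>auto simp: LIM_zero tendsto_norm_zero\<close>)
      then show "(\<lambda>k. indicator ?I t *\<^sub>R norm (F k t - f t) powr p) \<longlonglongrightarrow> 0"
        by (cases "t \<in> ?I") auto
    qed
    show "AE t in lborel. norm (indicator ?I t *\<^sub>R norm (F k t - f t) powr p) \<le> indicator ?I t *\<^sub>R ((G + G) powr p)" for k
    proof (rule AE_I2)
      fix t
      have "norm (F k t - f t) powr p \<le> (G + G) powr p" if "t \<in> ?I"
        using p G[OF that, of k] fG[OF that] by (intro powr_mono2 order_trans[OF norm_triangle_ineq4] add_mono) auto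
      then show "norm (indicator ?I t *\<^sub>R norm (F k t - f t) powr p) \<le> indicator ?I t *\<^sub>R ((G + G) powr p)"
        by (auto simp: indicator_def)
    qed
  qed (use powr[OF diff] const in \<open>auto simp: set_borel_measurable_def set_integrable_def\<close>)
  then have "(\<lambda>k. LINT t:?I|lborel. norm (F k t - f t) powr p) \<longlonglongrightarrow> 0" by simp
  then have "(\<lambda>k. Lp_norm p ?I (\<lambda>t. F k t - f t)) \<longlonglongrightarrow> 0"
    unfolding Lp_norm_def
    by (rule tendsto_zero_powrI[where b = "1 / p"])
      (use p in \<open>auto simp: set_lebesgue_integral_def intro!: integral_nonneg_AE AE_I2\<close>)
  then show ?thesis
    unfolding Lp_convergent_def using Lp[OF F G] Lp[OF f fG] by blast
qed

section \<open>Weak derivatives\<close>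

lemma finite_measure_interval: "finite_measure (restrict_space lborel {a<..<b::real})"
  using emeasure_interval_finite[of a b]
  by (intro finite_measureI) (simp add: emeasure_restrict_space space_restrict_space)

text \<open>Passes from indicator-weighted integrals to the restricted measure, which is finite, so
  that the Cauchy-Schwarz and completeness results above apply.\<close>

lemma in_Lp_2_iff:
  "in_Lp 2 {a<..<b} f \<longleftrightarrow> f \<in> borel_measurable (restrict_space lborel {a<..<b})
     \<and> integrable (restrict_space lborel {a<..<b}) (\<lambda>t. (norm (f t))\<^sup>2)"
  unfolding in_Lp_def set_borel_measurable_def
  by (subst borel_measurable_restrict_space_iff) (auto simp: set_integrable_eq)

lemma LINT_interval_eq:
  fixes f :: "real \<Rightarrow> 'a::{banach, second_countable_topology}"
  shows "(LINT t:{a<..<b}|lborel. f t) = integral\<^sup>L (restrict_space lborel {a<..<b}) f"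
  by (simp add: set_lebesgue_integral_def integral_restrict_space)

lemma in_Lp_2_set_integrable:
  assumes "in_Lp 2 {a<..<b} f"
  shows "set_integrable lborel {a<..<b} f"
proof -
  interpret finite_measure "restrict_space lborel {a<..<b}" by (rule finite_measure_interval)
  show ?thesis
    using assms square_integrable_imp_integrable by (auto simp: in_Lp_2_iff set_integrable_eq)
qed

lemma set_borel_measurable_scaleR:
  assumes "set_borel_measurable M A f" "set_borel_measurable M A g"
  shows "set_borel_measurable M A (\<lambda>t. f t *\<^sub>R (g t :: 'a::{real_normed_vector, second_countable_topology}))"
proof -
  have "(\<lambda>t. (indicator A t *\<^sub>R f t) *\<^sub>R (indicator A t *\<^sub>R g t)) \<in> borel_measurable M"
    using assms unfolding set_borel_measurable_def by measurable
  also have "(\<lambda>t. (indicator A t *\<^sub>R f t) *\<^sub>R (indicator A t *\<^sub>R g t)) = (\<lambda>t. indicator A t *\<^sub>R (f t *\<^sub>R g t))"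
    by (auto simp: indicator_def)
  finally show ?thesis unfolding set_borel_measurable_def .
qed

lemma set_borel_measurable_continuous_on:
  fixes f :: "real \<Rightarrow> 'a::{real_normed_vector, second_countable_topology}"
  assumes "continuous_on A f" "A \<in> sets borel"
  shows "set_borel_measurable lborel A f"
  using assms set_measurable_continuous_on[of A f] unfolding set_borel_measurable_def by simp

lemma set_integrable_scaleR_bounded:
  fixes f :: "real \<Rightarrow> real" and g :: "real \<Rightarrow> 'a::euclidean_space"
  assumes "set_borel_measurable lborel A f" "\<And>t. t \<in> A \<Longrightarrow> \<bar>f t\<bar> \<le> B" "set_integrable lborel A g"
  shows "set_integrable lborel A (\<lambda>t. f t *\<^sub>R g t)"
proof (rule set_integrable_bound[where f = "\<lambda>t. B *\<^sub>R g t"])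
  show "set_integrable lborel A (\<lambda>t. B *\<^sub>R g t)" using assms(3) by auto
  have "set_borel_measurable lborel A g"
    using assms(3) unfolding set_integrable_def set_borel_measurable_def by (rule borel_measurable_integrable)
  then show "set_borel_measurable lborel A (\<lambda>t. f t *\<^sub>R g t)"
    using assms(1) set_borel_measurable_scaleR by blast
  show "AE x\<in>A in lborel. norm (f x *\<^sub>R g x) \<le> norm (B *\<^sub>R g x)"
    using assms(2) by (intro AE_I2) (fastforce intro!: mult_right_mono)
qed

lemma C1_test_functionE:
  assumes "C1_test_function a b \<phi> \<phi>'"
  obtains B where "0 < B" "\<And>t. t \<in> {a..b} \<Longrightarrow> \<bar>\<phi> t\<bar> \<le> B" "\<And>t. t \<in> {a..b} \<Longrightarrow> \<bar>\<phi>' t\<bar> \<le> B"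
    "continuous_on UNIV \<phi>" "continuous_on UNIV \<phi>'" "\<And>t. (\<phi> has_real_derivative \<phi>' t) (at t)"
    "\<phi> a = 0" "\<phi> b = 0"
proof -
  have d: "\<And>t. (\<phi> has_real_derivative \<phi>' t) (at t)" and c': "continuous_on UNIV \<phi>'"
    using assms by (auto simp: C1_test_function_def)
  have c: "continuous_on UNIV \<phi>"
    using d by (meson DERIV_continuous_on has_field_derivative_at_within)
  have "bounded (\<phi> ` {a..b})" "bounded (\<phi>' ` {a..b})"
    by (intro compact_imp_bounded compact_continuous_image continuous_on_subset[OF c]
          continuous_on_subset[OF c']; auto)+
  then obtain B1 B2 where "\<forall>t\<in>{a..b}. \<bar>\<phi> t\<bar> \<le> B1" "\<forall>t\<in>{a..b}. \<bar>\<phi>' t\<bar> \<le> B2"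
    unfolding bounded_iff by (metis imageI real_norm_def)
  then have "\<And>t. t \<in> {a..b} \<Longrightarrow> \<bar>\<phi> t\<bar> \<le> max 1 (max B1 B2)" "\<And>t. t \<in> {a..b} \<Longrightarrow> \<bar>\<phi>' t\<bar> \<le> max 1 (max B1 B2)"
    by fastforce+
  moreover have "\<phi> a = 0" "\<phi> b = 0"
    using assms by (auto simp: C1_test_function_def)
  ultimately show ?thesis using that[of "max 1 (max B1 B2)"] c c' d by auto
qed

text \<open>Integration by parts: the product of \<open>u\<close> with a test function vanishes at
  both ends, so the integral of its derivative is zero. Continuity of \<open>u\<close> across the
  finite set \<open>S\<close> lets the fundamental theorem of calculus ignore the corners
  there.\<close>

lemma has_weak_derivI:
  fixes u g :: "real \<Rightarrow> 'a::euclidean_space"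
  assumes "a \<le> b" "finite S" and u: "continuous_on {a..b} u"
    and der: "\<And>t. t \<in> {a<..<b} - S \<Longrightarrow> (u has_vector_derivative g t) (at t)"
    and g: "set_borel_measurable lborel {a<..<b} g" "\<And>t. t \<in> {a<..<b} \<Longrightarrow> norm (g t) \<le> G"
  shows "has_weak_deriv a b u g"
proof -
  let ?I = "{a<..<b}"
  have finI: "set_integrable lborel ?I (\<lambda>_. c)" for c :: "'c::euclidean_space"
    unfolding set_integrable_def by (intro integrable_scaleR_left) (use emeasure_interval_finite[of a b] in \<open>auto simp: integrable_indicator_iff\<close>)
  have gi: "set_integrable lborel ?I g"
  proof (rule set_integrable_bound[OF finI[of G] g(1)])
    have "norm (g t) \<le> norm G" if "t \<in> ?I" for t using g(2)[OF that] by simp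
    then show "AE t\<in>?I in lborel. norm (g t) \<le> norm G" by (intro AE_I2) blast
  qed
  have "in_Lp 2 ?I g"
    unfolding in_Lp_2_iff
  proof
    show m: "g \<in> borel_measurable (restrict_space lborel ?I)"
      using g(1) unfolding set_borel_measurable_def by (subst borel_measurable_restrict_space_iff) auto
    interpret finite_measure "restrict_space lborel ?I" by (rule finite_measure_interval)
    show "integrable (restrict_space lborel ?I) (\<lambda>t. (norm (g t))\<^sup>2)"
      by (rule integrable_const_bound[where B = "G\<^sup>2"])
        (use m g(2) in \<open>auto intro!: AE_I2 power_mono simp: space_restrict_space\<close>)
  qed
  moreover have "(LINT t:?I|lborel. \<phi>' t *\<^sub>R u t) = - (LINT t:?I|lborel. \<phi> t *\<^sub>R g t)"
    if t: "C1_test_function a b \<phi> \<phi>'" for \<phi> \<phi>'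
  proof -
    from t obtain B where B: "0 < B" "\<And>t. t \<in> {a..b} \<Longrightarrow> \<bar>\<phi> t\<bar> \<le> B" "\<And>t. t \<in> {a..b} \<Longrightarrow> \<bar>\<phi>' t\<bar> \<le> B"
      "continuous_on UNIV \<phi>" "continuous_on UNIV \<phi>'" "\<And>t. (\<phi> has_real_derivative \<phi>' t) (at t)"
      "\<phi> a = 0" "\<phi> b = 0" using C1_test_functionE by metis
    have "continuous_on {a..b} (\<lambda>t. \<phi> t *\<^sub>R u t)"
      by (intro continuous_intros u continuous_on_subset[OF B(4)]) auto
    moreover have "((\<lambda>t. \<phi> t *\<^sub>R u t) has_vector_derivative \<phi>' t *\<^sub>R u t + \<phi> t *\<^sub>R g t) (at t)"
      if "t \<in> ?I - S" for t
      using has_vector_derivative_scaleR[OF B(6) der[OF that]] by (simp add: add.commute)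
    ultimately have "((\<lambda>t. \<phi>' t *\<^sub>R u t + \<phi> t *\<^sub>R g t) has_integral 0) {a..b}"
      using fundamental_theorem_of_calculus_interior_strong[OF \<open>finite S\<close> \<open>a \<le> b\<close>,
          of "\<lambda>t. \<phi> t *\<^sub>R u t" "\<lambda>t. \<phi>' t *\<^sub>R u t + \<phi> t *\<^sub>R g t"] B(7,8) by simp
    then have "((\<lambda>t. \<phi>' t *\<^sub>R u t + \<phi> t *\<^sub>R g t) has_integral 0) ?I"
      by (simp add: has_integral_Icc_iff_Ioo)
    moreover have i1: "set_integrable lborel ?I (\<lambda>t. \<phi>' t *\<^sub>R u t)"
    proof -
      have "set_integrable lborel {a..b} (\<lambda>t. \<phi>' t *\<^sub>R u t)"
        unfolding set_integrable_def
        by (intro borel_integrable_compact continuous_intros u continuous_on_subset[OF B(5)]) auto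
      then show ?thesis by (rule set_integrable_subset) auto
    qed
    moreover have i2: "set_integrable lborel ?I (\<lambda>t. \<phi> t *\<^sub>R g t)"
      by (rule set_integrable_scaleR_bounded[where B = B, OF _ _ gi])
        (use B in \<open>auto intro!: set_borel_measurable_continuous_on intro: continuous_on_subset\<close>)
    ultimately have "(LINT t:?I|lborel. \<phi>' t *\<^sub>R u t + \<phi> t *\<^sub>R g t) = 0"
      by (subst set_borel_integral_eq_integral(2)) (auto intro: integral_unique)
    then show ?thesis
      using set_integral_add(2)[OF i1 i2] by (simp add: eq_neg_iff_add_eq_0)
  qed
  ultimately show ?thesis unfolding has_weak_deriv_def by blast
qed

text \<open>As $n \to \infty$ these test functions converge boundedly to the indicator of $(c,d)$.\<close>

lemma C1_cutoff:
  fixes c d n :: real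
  assumes "a < c" "c \<le> d" "d < b" "0 \<le> n"
  defines "y \<equiv> \<lambda>x. max 0 ((x - c) * (d - x))"
  shows "C1_test_function a b (\<lambda>x. 1 - 1 / (1 + n * (y x)\<^sup>2))
    (\<lambda>x. 2 * n * y x * (c + d - 2 * x) / (1 + n * (y x)\<^sup>2)\<^sup>2)"
proof -
  have pos: "1 + n * (y x)\<^sup>2 > 0" for x using assms(4) by (simp add: add_pos_nonneg)
  \<comment> \<open>The positive part has a corner at 0, but its square is C^1: at 0 the difference
    quotient is at most |h| in size. This is why \<open>y\<close> enters the cutoff only through its
    square.\<close>
  have sq: "((\<lambda>z::real. (max 0 z)\<^sup>2) has_real_derivative 2 * max 0 z) (at z)" for z
  proof -
    consider "z > 0" | "z < 0" | "z = 0" by linarith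
    then show ?thesis
    proof cases
      case 1
      have "((\<lambda>z::real. z\<^sup>2) has_real_derivative 2 * max 0 z) (at z)"
        using 1 by (auto intro!: derivative_eq_intros)
      then show ?thesis
        by (rule has_field_derivative_transform_within_open[where S = "{0<..}"]) (use 1 in auto)
    next
      case 2
      have "((\<lambda>z::real. 0) has_real_derivative 2 * max 0 z) (at z)"
        using 2 by (auto intro!: derivative_eq_intros)
      then show ?thesis
        by (rule has_field_derivative_transform_within_open[where S = "{..<0}"]) (use 2 in auto)
    next
      case 3
      have "((\<lambda>h::real. (max 0 h)\<^sup>2 / h) \<longlongrightarrow> 0) (at 0)"
      proof (rule Lim_null_comparison[where g = "\<lambda>h. \<bar>h\<bar>"])
        show "\<forall>\<^sub>F h::real in at 0. norm ((max 0 h)\<^sup>2 / h) \<le> \<bar>h\<bar>"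
          by (intro always_eventually) (auto simp: max_def power2_eq_square)
      qed (auto intro!: tendsto_eq_intros)
      then show ?thesis using 3 by (simp add: has_field_derivative_iff)
    qed
  qed
  have dy: "((\<lambda>x. (y x)\<^sup>2) has_real_derivative 2 * y x * (c + d - 2 * x)) (at x)" for x
    unfolding y_def
    by (rule DERIV_cong, rule DERIV_chain2[OF sq])
      (auto intro!: derivative_eq_intros simp: algebra_simps)
  have "continuous_on UNIV (\<lambda>x. 2 * n * y x * (c + d - 2 * x) / (1 + n * (y x)\<^sup>2)\<^sup>2)"
    using pos unfolding y_def by (intro continuous_intros) (auto simp: less_imp_neq[symmetric])
  moreover have "((\<lambda>x. 1 - 1 / (1 + n * (y x)\<^sup>2)) has_real_derivative
      2 * n * y x * (c + d - 2 * x) / (1 + n * (y x)\<^sup>2)\<^sup>2) (at x)" for x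
    proof -
    have "((\<lambda>x. 1 + n * (y x)\<^sup>2) has_real_derivative n * (2 * y x * (c + d - 2 * x))) (at x)"
      by (rule DERIV_cong, rule DERIV_add[OF DERIV_const DERIV_cmult[OF dy]]) simp
    from DERIV_diff[OF DERIV_const[where k = 1] DERIV_divide[OF DERIV_const[where k = 1] this]] show ?thesis
      using pos[of x] by (simp add: power2_eq_square mult_ac)
  qed
  moreover have "y x = 0" if "x \<notin> {c..d}" for x
    using that assms(2) unfolding y_def by (auto simp: max_def zero_le_mult_iff)
  ultimately show ?thesis
    using assms(1,3) unfolding C1_test_function_def
    by (intro conjI allI exI[of _ c] exI[of _ d] impI) simp_all
qed

text \<open>The fundamental lemma of the calculus of variations in integrated form. Vanishing
  integrals over subintervals are all that comparing two weak derivatives requires, so f = 0 almost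
  everywhere is never derived.\<close>

lemma weak_zero_imp_LINT_eq_0:
  fixes f :: "real \<Rightarrow> 'a::euclidean_space"
  assumes int: "set_integrable lborel {a<..<b} f"
    and orth: "\<And>\<phi> \<phi>'. C1_test_function a b \<phi> \<phi>' \<Longrightarrow> (LINT t:{a<..<b}|lborel. \<phi> t *\<^sub>R f t) = 0"
    and st: "a \<le> s" "s < t" "t \<le> b"
  shows "(LINT x:{s<..<t}|lborel. f x) = 0"
proof -
  let ?I = "{a<..<b}"
  \<comment> \<open>The cutoffs live on [s + \<delta>, t - \<delta>], hence have compact support in
    (a,b) even if s = a or t = b. The offset 3 gives 3\<delta> \<le> t - s for every n, so these
    intervals are never empty.\<close>
  define \<delta> where "\<delta> n = (t - s) / real (n + 3)" for n :: nat
  define y where "y n x = max 0 ((x - (s + \<delta> n)) * (t - \<delta> n - x))" for n x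
  define \<phi> where "\<phi> n x = 1 - 1 / (1 + real n * (y n x)\<^sup>2)" for n x
  have \<delta>: "0 < \<delta> n" "3 * \<delta> n \<le> t - s" for n
    using st mult_right_mono[of s t "real n"] by (auto simp: \<delta>_def field_simps)
  have \<delta>lim: "\<delta> \<longlonglongrightarrow> 0"
    unfolding \<delta>_def by (rule tendsto_divide_0[OF tendsto_const])
      (intro filterlim_at_top_imp_at_infinity filterlim_compose[OF filterlim_real_sequentially] filterlim_add_const_nat_at_top)
  have test: "\<exists>\<phi>'. C1_test_function a b (\<phi> n) \<phi>'" for n
    unfolding \<phi>_def y_def
    using C1_cutoff[of a "s + \<delta> n" "t - \<delta> n" b "real n"] \<delta>[of n] st by (auto simp: algebra_simps)
  have bound: "0 \<le> \<phi> n x" "\<phi> n x \<le> 1" for n x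
    unfolding \<phi>_def by (auto simp: divide_le_eq_1 add_pos_nonneg intro!: divide_nonneg_nonneg)
  have lim: "(\<lambda>n. \<phi> n x) \<longlonglongrightarrow> indicator {s<..<t} x" for x
  proof (cases "x \<in> {s<..<t}")
    case True
    have "(\<lambda>n. y n x) \<longlonglongrightarrow> max 0 ((x - (s + 0)) * (t - 0 - x))"
      unfolding y_def by (intro tendsto_intros \<delta>lim)
    then have "(\<lambda>n. (y n x)\<^sup>2) \<longlonglongrightarrow> (max 0 ((x - (s + 0)) * (t - 0 - x)))\<^sup>2"
      by (intro tendsto_intros)
    moreover have "(max 0 ((x - (s + 0)) * (t - 0 - x)))\<^sup>2 > 0"
      using True by (auto simp: max_def not_le mult_le_0_iff)
    ultimately have "filterlim (\<lambda>n. (y n x)\<^sup>2 * real n) at_top sequentially"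
      by (rule filterlim_tendsto_pos_mult_at_top) (rule filterlim_real_sequentially)
    then have "filterlim (\<lambda>n. 1 + (y n x)\<^sup>2 * real n) at_top sequentially"
      by (intro filterlim_tendsto_add_at_top[OF tendsto_const])
    then have "(\<lambda>n. 1 / (1 + (y n x)\<^sup>2 * real n)) \<longlonglongrightarrow> 0"
      by (intro tendsto_divide_0[OF tendsto_const] filterlim_at_top_imp_at_infinity)
    then have "(\<lambda>n. 1 - 1 / (1 + (y n x)\<^sup>2 * real n)) \<longlonglongrightarrow> 1 - 0"
      by (intro tendsto_intros)
    then show ?thesis using True unfolding \<phi>_def by (simp add: mult.commute)
  next
    case False
    have "y n x = 0" for n
    proof -
      consider "x \<le> s" | "t \<le> x" using False by force
      then have "(x - (s + \<delta> n)) * (t - \<delta> n - x) \<le> 0"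
      proof cases
        case 1 then show ?thesis using \<delta>[of n] by (intro mult_nonpos_nonneg) auto
      next
        case 2 then show ?thesis using \<delta>[of n] by (intro mult_nonneg_nonpos) auto
      qed
      then show ?thesis by (simp add: y_def)
    qed
    then show ?thesis using False by (simp add: \<phi>_def)
  qed
  have "(\<lambda>n. LINT x|lborel. indicator ?I x *\<^sub>R (\<phi> n x *\<^sub>R f x)) \<longlonglongrightarrow>
      (LINT x|lborel. indicator {s<..<t} x *\<^sub>R f x)"
  proof (rule integral_dominated_convergence[where w = "\<lambda>x. norm (indicator ?I x *\<^sub>R f x)"])
    have mI: "(\<lambda>x. indicator ?I x *\<^sub>R f x) \<in> borel_measurable lborel"
      using int unfolding set_integrable_def by (rule borel_measurable_integrable)
    have "set_integrable lborel {s<..<t} f"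
      by (rule set_integrable_subset[OF int]) (use st in auto)
    then show "(\<lambda>x. indicator {s<..<t} x *\<^sub>R f x) \<in> borel_measurable lborel"
      unfolding set_integrable_def by (rule borel_measurable_integrable)
    show "(\<lambda>x. indicator ?I x *\<^sub>R (\<phi> n x *\<^sub>R f x)) \<in> borel_measurable lborel" for n
    proof -
      have "(\<lambda>x. \<phi> n x *\<^sub>R (indicator ?I x *\<^sub>R f x)) \<in> borel_measurable lborel"
        unfolding \<phi>_def y_def using mI by measurable
      then show ?thesis by (simp add: mult.commute)
    qed
    show "integrable lborel (\<lambda>x. norm (indicator ?I x *\<^sub>R f x))"
      using int unfolding set_integrable_def by (rule integrable_norm)
    show "AE x in lborel. (\<lambda>n. indicator ?I x *\<^sub>R (\<phi> n x *\<^sub>R f x)) \<longlonglongrightarrow> indicator {s<..<t} x *\<^sub>R f x"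
    proof (rule AE_I2)
      fix x
      have "(\<lambda>n. indicator ?I x *\<^sub>R (\<phi> n x *\<^sub>R f x)) \<longlonglongrightarrow> indicator ?I x *\<^sub>R (indicator {s<..<t} x *\<^sub>R f x)"
        by (intro tendsto_intros lim)
      also have "indicator ?I x *\<^sub>R (indicator {s<..<t} x *\<^sub>R f x) = indicator {s<..<t} x *\<^sub>R f x"
        using st by (auto simp: indicator_def)
      finally show "(\<lambda>n. indicator ?I x *\<^sub>R (\<phi> n x *\<^sub>R f x)) \<longlonglongrightarrow> indicator {s<..<t} x *\<^sub>R f x" .
    qed
    show "AE x in lborel. norm (indicator ?I x *\<^sub>R (\<phi> n x *\<^sub>R f x)) \<le> norm (indicator ?I x *\<^sub>R f x)" for n
      by (intro AE_I2) (use bound[of n] in \<open>auto simp: indicator_def mult_left_le_one_le\<close>)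
  qed
  moreover have "(LINT x|lborel. indicator ?I x *\<^sub>R (\<phi> n x *\<^sub>R f x)) = 0" for n
    using test[of n] orth[of "\<phi> n"] unfolding set_lebesgue_integral_def by blast
  ultimately have "(LINT x|lborel. indicator {s<..<t} x *\<^sub>R f x) = 0"
    by (simp add: LIMSEQ_const_iff)
  then show ?thesis by (simp add: set_lebesgue_integral_def)
qed

text \<open>The given derivatives \<open>w k\<close> need not converge in norm. They are replaced by
  other weak derivatives, of functions still uniformly close to \<open>u\<close>, chosen nearly
  minimal in L^2 and therefore strongly convergent. The functions \<open>z n\<close> behind them
  converge to \<open>u\<close>, so both sides of the weak identity pass to the limit.\<close>

lemma in_H1_uniform_limit:
  fixes u :: "real \<Rightarrow> 'a::euclidean_space"
  assumes v: "\<And>k. in_Lp 2 {a<..<b} (v k)" and w: "\<And>k. has_weak_deriv a b (v k) (w k)"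
    and K: "\<And>k. (LINT t:{a<..<b}|lborel. (norm (w k t))\<^sup>2) \<le> K"
    and lim: "uniform_limit {a<..<b} v u sequentially"
  shows "in_H1 a b u"
proof -
  let ?I = "{a<..<b}"
  let ?M = "restrict_space lborel {a<..<b}"
  interpret finite_measure ?M by (rule finite_measure_interval)
  have spM: "space ?M = ?I" by (simp add: space_restrict_space)
  \<comment> \<open>Midpoint convex because the weak derivative is linear and uniform balls around
    \<open>u\<close> are convex; decreasing because the tolerance shrinks. Each \<open>S n\<close>
    contains some \<open>w k\<close>, which supplies the common bound \<open>K\<close>.\<close>
  define S where "S n = {g. \<exists>f. in_Lp 2 ?I f \<and> has_weak_deriv a b f g \<and>
      (\<forall>t\<in>?I. norm (f t - u t) \<le> 1 / real (Suc n))}" for n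
  have close: "\<exists>k. \<forall>t\<in>?I. norm (v k t - u t) \<le> 1 / real (Suc n)" for n
  proof -
    have "\<forall>\<^sub>F k in sequentially. \<forall>t\<in>?I. dist (v k t) (u t) < 1 / real (Suc n)"
      using uniform_limitD[OF lim, of "1 / real (Suc n)"] by simp
    then show ?thesis
      unfolding eventually_sequentially dist_norm by (meson less_imp_le order_refl)
  qed
  have SD: "\<exists>f. in_Lp 2 ?I f \<and> has_weak_deriv a b f g \<and> (\<forall>t\<in>?I. norm (f t - u t) \<le> 1 / real (Suc n))"
    if "g \<in> S n" for g n
    using that unfolding S_def by (rule CollectD)
  have Sw: "g \<in> borel_measurable ?M" "integrable ?M (\<lambda>t. (norm (g t))\<^sup>2)" if "g \<in> S n" for g n
    using that unfolding S_def has_weak_deriv_def in_Lp_2_iff by auto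
  have um: "u \<in> borel_measurable ?M"
  proof (rule borel_measurable_LIMSEQ_metric)
    show "v k \<in> borel_measurable ?M" for k using v unfolding in_Lp_2_iff by auto
    show "(\<lambda>k. v k t) \<longlonglongrightarrow> u t" if "t \<in> space ?M" for t
      using tendsto_uniform_limitI[OF lim] that spM by auto
  qed
  \<comment> \<open>\<open>u\<close> is \<open>v k\<close> minus a function bounded by 1, and
    bounded measurable functions are square-integrable on a finite measure space.\<close>
  have uLp: "in_Lp 2 ?I u"
  proof -
    obtain k where k: "\<forall>t\<in>?I. norm (v k t - u t) \<le> 1" using close[of 0] by auto
    have vm: "v k \<in> borel_measurable ?M" "integrable ?M (\<lambda>t. (norm (v k t))\<^sup>2)"
      using v[of k] unfolding in_Lp_2_iff by auto
    have "integrable ?M (\<lambda>t. (norm (v k t - u t))\<^sup>2)"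
      by (rule integrable_const_bound[where B = 1])
        (use k vm um in \<open>auto intro!: AE_I2 power_le_one simp: spM\<close>)
    then have "integrable ?M (\<lambda>t. (norm (v k t - (v k t - u t)))\<^sup>2)"
      by (rule integrable_norm_diff_sq[OF vm(1) borel_measurable_diff[OF vm(1) um] vm(2)])
    then show ?thesis using um unfolding in_Lp_2_iff by simp
  qed
  have mid: "(\<lambda>t. (1/2) *\<^sub>R (f t + g t)) \<in> S n" if "f \<in> S n" "g \<in> S n" for f g n
  proof -
    obtain f0 where f0: "in_Lp 2 ?I f0" "has_weak_deriv a b f0 f" "\<forall>t\<in>?I. norm (f0 t - u t) \<le> 1 / real (Suc n)"
      using SD[OF \<open>f \<in> S n\<close>] by (elim exE conjE)
    obtain g0 where g0: "in_Lp 2 ?I g0" "has_weak_deriv a b g0 g" "\<forall>t\<in>?I. norm (g0 t - u t) \<le> 1 / real (Suc n)"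
      using SD[OF \<open>g \<in> S n\<close>] by (elim exE conjE)
    have Lp: "in_Lp 2 ?I (\<lambda>t. (1/2) *\<^sub>R (p t + q t))" if "in_Lp 2 ?I p" "in_Lp 2 ?I q" for p q :: "real \<Rightarrow> 'a"
    proof -
      have "p \<in> borel_measurable ?M" "q \<in> borel_measurable ?M"
        "integrable ?M (\<lambda>t. (norm (p t))\<^sup>2)" "integrable ?M (\<lambda>t. (norm (q t))\<^sup>2)"
        using that unfolding in_Lp_2_iff by auto
      moreover from this have "integrable ?M (\<lambda>t. (norm (p t - - q t))\<^sup>2)"
        by (intro integrable_norm_diff_sq) auto
      ultimately show ?thesis unfolding in_Lp_2_iff by (auto simp: power_divide)
    qed
    have lin: "(LINT t:?I|lborel. \<psi> t *\<^sub>R ((1/2) *\<^sub>R (p t + q t)))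
        = (1/2) *\<^sub>R ((LINT t:?I|lborel. \<psi> t *\<^sub>R p t) + (LINT t:?I|lborel. \<psi> t *\<^sub>R q t))"
      if "in_Lp 2 ?I p" "in_Lp 2 ?I q" "continuous_on UNIV \<psi>" "\<And>t. t \<in> {a..b} \<Longrightarrow> \<bar>\<psi> t\<bar> \<le> B"
      for \<psi> B and p q :: "real \<Rightarrow> 'a"
    proof -
      have "set_borel_measurable lborel ?I \<psi>"
        by (intro set_borel_measurable_continuous_on continuous_on_subset[OF that(3)]) auto
      then have "set_integrable lborel ?I (\<lambda>t. \<psi> t *\<^sub>R p t)" "set_integrable lborel ?I (\<lambda>t. \<psi> t *\<^sub>R q t)"
        by (intro set_integrable_scaleR_bounded[where B = B] in_Lp_2_set_integrable; use that in auto)+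
      note add = set_integral_add(2)[OF this]
      have "\<psi> t *\<^sub>R ((1/2) *\<^sub>R (p t + q t)) = (1/2) *\<^sub>R (\<psi> t *\<^sub>R p t + \<psi> t *\<^sub>R q t)" for t
        by (simp add: scaleR_add_right mult.commute)
      then show ?thesis by (simp only: set_integral_scaleR_right add)
    qed
    have "has_weak_deriv a b (\<lambda>t. (1/2) *\<^sub>R (f0 t + g0 t)) (\<lambda>t. (1/2) *\<^sub>R (f t + g t))"
      unfolding has_weak_deriv_def
    proof (intro conjI allI impI)
      show "in_Lp 2 ?I (\<lambda>t. (1/2) *\<^sub>R (f t + g t))"
        using f0(2) g0(2) by (intro Lp) (auto simp: has_weak_deriv_def)
      fix \<phi> \<phi>' assume t: "C1_test_function a b \<phi> \<phi>'"
      obtain B where B: "\<And>t. t \<in> {a..b} \<Longrightarrow> \<bar>\<phi> t\<bar> \<le> B" "\<And>t. t \<in> {a..b} \<Longrightarrow> \<bar>\<phi>' t\<bar> \<le> B"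
        "continuous_on UNIV \<phi>" "continuous_on UNIV \<phi>'" using C1_test_functionE[OF t] by metis
      have "(LINT t:?I|lborel. \<phi>' t *\<^sub>R f0 t) = - (LINT t:?I|lborel. \<phi> t *\<^sub>R f t)"
        "(LINT t:?I|lborel. \<phi>' t *\<^sub>R g0 t) = - (LINT t:?I|lborel. \<phi> t *\<^sub>R g t)"
        using t f0(2) g0(2) by (auto simp: has_weak_deriv_def)
      moreover have "in_Lp 2 ?I f" "in_Lp 2 ?I g" using f0(2) g0(2) by (auto simp: has_weak_deriv_def)
      ultimately show "(LINT t:?I|lborel. \<phi>' t *\<^sub>R ((1/2) *\<^sub>R (f0 t + g0 t)))
          = - (LINT t:?I|lborel. \<phi> t *\<^sub>R ((1/2) *\<^sub>R (f t + g t)))"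
        using lin[OF f0(1) g0(1) B(4,2)] lin[OF _ _ B(3,1), of f g] by (simp add: algebra_simps)
    qed
    moreover have "norm ((1/2) *\<^sub>R (f0 t + g0 t) - u t) \<le> 1 / real (Suc n)" if "t \<in> ?I" for t
    proof -
      have "(1/2) *\<^sub>R (f0 t + g0 t) - u t = (1/2) *\<^sub>R (f0 t - u t) + (1/2) *\<^sub>R (g0 t - u t)"
        by (simp add: algebra_simps flip: scaleR_add_left)
      also have "norm \<dots> \<le> norm ((1/2) *\<^sub>R (f0 t - u t)) + norm ((1/2) *\<^sub>R (g0 t - u t))"
        by (rule norm_triangle_ineq)
      also have "\<dots> \<le> (1/2) * (1 / real (Suc n)) + (1/2) * (1 / real (Suc n))"
        unfolding norm_scaleR using f0(3) g0(3) that by (intro add_mono mult_mono) auto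
      finally show ?thesis by (simp add: field_simps)
    qed
    ultimately show ?thesis
      unfolding S_def by (intro CollectI exI conjI ballI) (rule Lp[OF f0(1) g0(1)])
  qed
  have bdd: "\<exists>f\<in>S n. (LINT t|?M. (norm (f t))\<^sup>2) \<le> K" for n
  proof -
    obtain k where "\<forall>t\<in>?I. norm (v k t - u t) \<le> 1 / real (Suc n)" using close by blast
    then have "w k \<in> S n"
      unfolding S_def by (intro CollectI exI[of _ "v k"] conjI v w)
    then show ?thesis using K[of k] unfolding LINT_interval_eq by blast
  qed
  have dec: "S n \<subseteq> S m" if "m \<le> n" for m n
  proof -
    have "1 / real (Suc n) \<le> 1 / real (Suc m)" using that by (intro divide_left_mono) auto
    then show ?thesis unfolding S_def by fastforce
  qed
  have "\<exists>f g. (\<forall>n. f n \<in> S n) \<and> g \<in> borel_measurable ?M \<and> integrable ?M (\<lambda>t. (norm (g t))\<^sup>2)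
      \<and> (\<lambda>n. LINT t|?M. (norm (f n t - g t))\<^sup>2) \<longlonglongrightarrow> 0"
    by (rule L2_nested_convex[of S ?M K, OF Sw dec mid bdd])
  then obtain f g where fS: "\<forall>n. f n \<in> S n"
    and g: "g \<in> borel_measurable ?M" "integrable ?M (\<lambda>t. (norm (g t))\<^sup>2)"
    and fg: "(\<lambda>n. LINT t|?M. (norm (f n t - g t))\<^sup>2) \<longlonglongrightarrow> 0"
    by (elim exE conjE)
  from fS have f: "f n \<in> S n" for n by (rule spec)
  have gLp: "in_Lp 2 ?I g" using g unfolding in_Lp_2_iff by auto
  have "\<forall>n. \<exists>z. in_Lp 2 ?I z \<and> has_weak_deriv a b z (f n) \<and> (\<forall>t\<in>?I. norm (z t - u t) \<le> 1 / real (Suc n))"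
    using SD[OF f] by (rule allI)
  then obtain z where "\<forall>n. in_Lp 2 ?I (z n) \<and> has_weak_deriv a b (z n) (f n) \<and>
      (\<forall>t\<in>?I. norm (z n t - u t) \<le> 1 / real (Suc n))"
    by (rule choice[THEN exE])
  then have z: "\<And>n. in_Lp 2 ?I (z n)" "\<And>n. has_weak_deriv a b (z n) (f n)"
    "\<And>n t. t \<in> ?I \<Longrightarrow> norm (z n t - u t) \<le> 1 / real (Suc n)"
    by simp_all
  have fLp: "in_Lp 2 ?I (f n)" for n using z(2) by (simp add: has_weak_deriv_def)
  have zu: "(\<lambda>n. LINT t|?M. (norm (z n t - u t))\<^sup>2) \<longlonglongrightarrow> 0"
  proof (rule Lim_null_comparison)
    show "\<forall>\<^sub>F n in sequentially. norm (LINT t|?M. (norm (z n t - u t))\<^sup>2) \<le> measure ?M (space ?M) * (1 / real (Suc n))\<^sup>2"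
    proof (intro always_eventually allI)
      fix n
      have "integrable ?M (\<lambda>t. (norm (z n t - u t))\<^sup>2)"
        using z(1)[of n] uLp unfolding in_Lp_2_iff by (intro integrable_norm_diff_sq) auto
      then have "(LINT t|?M. (norm (z n t - u t))\<^sup>2) \<le> (LINT t|?M. (1 / real (Suc n))\<^sup>2)"
        by (intro integral_mono power_mono) (auto simp: spM intro!: z(3)[simplified])
      then show "norm (LINT t|?M. (norm (z n t - u t))\<^sup>2) \<le> measure ?M (space ?M) * (1 / real (Suc n))\<^sup>2"
        by simp
    qed
    have "(\<lambda>n. measure ?M (space ?M) * (1 / real (Suc n))\<^sup>2) \<longlonglongrightarrow> measure ?M (space ?M) * 0\<^sup>2"
      by (intro tendsto_intros LIMSEQ_Suc lim_1_over_n)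
    then show "(\<lambda>n. measure ?M (space ?M) * (1 / real (Suc n))\<^sup>2) \<longlonglongrightarrow> 0" by simp
  qed
  \<comment> \<open>Pairing with a bounded continuous function is continuous in L^2, by
    Cauchy-Schwarz for the product. It is used both for the functions \<open>z n\<close> with
    \<phi>' and for the derivatives \<open>f n\<close> with \<phi>.\<close>
  have conv: "(\<lambda>n. LINT t:?I|lborel. \<psi> t *\<^sub>R p n t) \<longlonglongrightarrow> (LINT t:?I|lborel. \<psi> t *\<^sub>R q t)"
    if p: "\<And>n. in_Lp 2 ?I (p n)" and q: "in_Lp 2 ?I q"
      and pq: "(\<lambda>n. LINT t|?M. (norm (p n t - q t))\<^sup>2) \<longlonglongrightarrow> 0"
      and \<psi>: "continuous_on UNIV \<psi>" "\<And>t. t \<in> {a..b} \<Longrightarrow> \<bar>\<psi> t\<bar> \<le> B"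
    for \<psi> B q and p :: "nat \<Rightarrow> real \<Rightarrow> 'a"
  proof -
    have m\<psi>: "set_borel_measurable lborel ?I \<psi>"
      by (intro set_borel_measurable_continuous_on continuous_on_subset[OF \<psi>(1)]) auto
    have m\<psi>': "\<psi> \<in> borel_measurable ?M"
      using m\<psi> unfolding set_borel_measurable_def by (subst borel_measurable_restrict_space_iff) auto
    have i: "set_integrable lborel ?I (\<lambda>t. \<psi> t *\<^sub>R r t)" if "in_Lp 2 ?I r" for r :: "real \<Rightarrow> 'a"
      by (rule set_integrable_scaleR_bounded[where B = B, OF m\<psi> _ in_Lp_2_set_integrable[OF that]])
        (use \<psi> in auto)
    have sq: "(norm ((LINT t:?I|lborel. \<psi> t *\<^sub>R p n t) - (LINT t:?I|lborel. \<psi> t *\<^sub>R q t)))\<^sup>2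
        \<le> measure ?M (space ?M) * (B\<^sup>2 * (LINT t|?M. (norm (p n t - q t))\<^sup>2))" for n
    proof -
      have pm: "p n \<in> borel_measurable ?M" "q \<in> borel_measurable ?M"
        using p[of n] q unfolding in_Lp_2_iff by auto
      have ipq: "integrable ?M (\<lambda>t. (norm (p n t - q t))\<^sup>2)"
        using p[of n] q unfolding in_Lp_2_iff by (intro integrable_norm_diff_sq) auto
      have le: "(norm (\<psi> t *\<^sub>R (p n t - q t)))\<^sup>2 \<le> B\<^sup>2 * (norm (p n t - q t))\<^sup>2" if "t \<in> ?I" for t
        using \<psi>(2)[of t] that by (auto simp: power_mult_distrib intro!: mult_right_mono) (metis abs_ge_zero power2_abs power_mono)
      have i2: "integrable ?M (\<lambda>t. (norm (\<psi> t *\<^sub>R (p n t - q t)))\<^sup>2)"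
        by (rule Bochner_Integration.integrable_bound[OF integrable_mult_right[OF ipq, of "B\<^sup>2"]])
          (use pm m\<psi>' le in \<open>auto intro!: AE_I2 simp: spM\<close>)
      have "(LINT t:?I|lborel. \<psi> t *\<^sub>R p n t) - (LINT t:?I|lborel. \<psi> t *\<^sub>R q t) = (LINT t|?M. \<psi> t *\<^sub>R (p n t - q t))"
        using set_integral_diff(2)[OF i[OF p] i[OF q]] unfolding LINT_interval_eq by (simp add: scaleR_diff_right)
      then have "(norm ((LINT t:?I|lborel. \<psi> t *\<^sub>R p n t) - (LINT t:?I|lborel. \<psi> t *\<^sub>R q t)))\<^sup>2
          \<le> measure ?M (space ?M) * (LINT t|?M. (norm (\<psi> t *\<^sub>R (p n t - q t)))\<^sup>2)"
        using norm_integral_sq_le[OF _ i2] pm m\<psi>' by simp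
      also have "\<dots> \<le> measure ?M (space ?M) * (LINT t|?M. B\<^sup>2 * (norm (p n t - q t))\<^sup>2)"
        by (intro mult_left_mono integral_mono i2 integrable_mult_right ipq) (auto simp: spM intro!: le[simplified])
      finally show ?thesis by simp
    qed
    have "(\<lambda>n. (norm ((LINT t:?I|lborel. \<psi> t *\<^sub>R p n t) - (LINT t:?I|lborel. \<psi> t *\<^sub>R q t)))\<^sup>2) \<longlonglongrightarrow> 0"
    proof (rule Lim_null_comparison)
      show "\<forall>\<^sub>F n in sequentially. norm ((norm ((LINT t:?I|lborel. \<psi> t *\<^sub>R p n t) - (LINT t:?I|lborel. \<psi> t *\<^sub>R q t)))\<^sup>2)
        \<le> measure ?M (space ?M) * (B\<^sup>2 * (LINT t|?M. (norm (p n t - q t))\<^sup>2))"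
        by (intro always_eventually allI) (use sq in simp)
      show "(\<lambda>n. measure ?M (space ?M) * (B\<^sup>2 * (LINT t|?M. (norm (p n t - q t))\<^sup>2))) \<longlonglongrightarrow> 0"
        by (intro tendsto_mult_right_zero pq)
    qed
    then have "(\<lambda>n. sqrt ((norm ((LINT t:?I|lborel. \<psi> t *\<^sub>R p n t) - (LINT t:?I|lborel. \<psi> t *\<^sub>R q t)))\<^sup>2)) \<longlonglongrightarrow> sqrt 0"
      by (intro tendsto_intros)
    then show ?thesis
      by (simp add: tendsto_norm_zero_iff LIM_zero_iff)
  qed
  have "has_weak_deriv a b u g"
    unfolding has_weak_deriv_def
  proof (intro conjI allI impI gLp)
    fix \<phi> \<phi>' assume t: "C1_test_function a b \<phi> \<phi>'"
    obtain B where B: "\<And>t. t \<in> {a..b} \<Longrightarrow> \<bar>\<phi> t\<bar> \<le> B" "\<And>t. t \<in> {a..b} \<Longrightarrow> \<bar>\<phi>' t\<bar> \<le> B"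
      "continuous_on UNIV \<phi>" "continuous_on UNIV \<phi>'" using C1_test_functionE[OF t] by metis
    have "(\<lambda>n. - (LINT t:?I|lborel. \<phi> t *\<^sub>R f n t)) \<longlonglongrightarrow> - (LINT t:?I|lborel. \<phi> t *\<^sub>R g t)"
      by (intro tendsto_minus conv[OF fLp gLp fg B(3,1)])
    moreover have "(LINT t:?I|lborel. \<phi>' t *\<^sub>R z n t) = - (LINT t:?I|lborel. \<phi> t *\<^sub>R f n t)" for n
      using z(2)[of n] t by (auto simp: has_weak_deriv_def)
    ultimately show "(LINT t:?I|lborel. \<phi>' t *\<^sub>R u t) = - (LINT t:?I|lborel. \<phi> t *\<^sub>R g t)"
      using LIMSEQ_unique[OF conv[OF z(1) uLp zu B(4,2)]] by simp
  qed
  then show ?thesis using uLp unfolding in_H1_def by blast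
qed

text \<open>Two derivatives play different roles: \<open>g\<close> is the explicit piecewise one,
  whose integral over (s,t) is the increment of \<open>u\<close>, while \<open>w\<close> is
  arbitrary and is the one whose norm is controlled. Their integrals over (s,t) coincide because
  \<open>g - w\<close> is orthogonal to all test functions; Cauchy-Schwarz for \<open>w\<close>
  finishes.\<close>

lemma Holder_of_weak_deriv:
  fixes u g w :: "real \<Rightarrow> 'a::euclidean_space"
  assumes "finite S" and u: "continuous_on {a..b} u"
    and der: "\<And>t. t \<in> {a<..<b} - S \<Longrightarrow> (u has_vector_derivative g t) (at t)"
    and g: "set_borel_measurable lborel {a<..<b} g" "\<And>t. t \<in> {a<..<b} \<Longrightarrow> norm (g t) \<le> G"
    and w: "has_weak_deriv a b u w"
    and st: "a \<le> s" "s < t" "t \<le> b"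
  shows "(norm (u t - u s))\<^sup>2 \<le> (t - s) * (LINT t:{a<..<b}|lborel. (norm (w t))\<^sup>2)"
proof -
  let ?I = "{a<..<b}" and ?J = "{s<..<t}"
  have wg: "has_weak_deriv a b u g"
    by (rule has_weak_derivI[OF _ \<open>finite S\<close> u der g]) (use st in auto)
  have gi: "set_integrable lborel ?I g" and wi: "set_integrable lborel ?I w"
    using wg w by (auto simp: has_weak_deriv_def intro: in_Lp_2_set_integrable)
  have "(LINT x:?J|lborel. g x - w x) = 0"
  proof (rule weak_zero_imp_LINT_eq_0[where a = a and b = b])
    show "set_integrable lborel ?I (\<lambda>x. g x - w x)" using gi wi by (rule set_integral_diff)
    fix \<phi> \<phi>' assume t: "C1_test_function a b \<phi> \<phi>'"
    obtain B where B: "\<And>t. t \<in> {a..b} \<Longrightarrow> \<bar>\<phi> t\<bar> \<le> B" "continuous_on UNIV \<phi>"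
      using C1_test_functionE[OF t] by metis
    have "set_borel_measurable lborel ?I \<phi>"
      by (intro set_borel_measurable_continuous_on continuous_on_subset[OF B(2)]) auto
    then have "set_integrable lborel ?I (\<lambda>x. \<phi> x *\<^sub>R g x)" "set_integrable lborel ?I (\<lambda>x. \<phi> x *\<^sub>R w x)"
      by (intro set_integrable_scaleR_bounded[where B = B] gi wi; use B in auto)+
    note diff = set_integral_diff(2)[OF this]
    have "(LINT x:?I|lborel. \<phi>' x *\<^sub>R u x) = - (LINT x:?I|lborel. \<phi> x *\<^sub>R h x)"
      if "has_weak_deriv a b u h" for h
      using that t unfolding has_weak_deriv_def by blast
    from this[OF wg] this[OF w] show "(LINT x:?I|lborel. \<phi> x *\<^sub>R (g x - w x)) = 0"
      by (simp add: scaleR_diff_right diff)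
  qed (use st in auto)
  moreover have gJ: "set_integrable lborel ?J g" "set_integrable lborel ?J w"
    using gi wi st by (auto intro: set_integrable_subset)
  ultimately have gw: "(LINT x:?J|lborel. g x) = (LINT x:?J|lborel. w x)"
    using set_integral_diff(2)[OF gJ] by simp
  have "(g has_integral u t - u s) {s..t}"
    by (rule fundamental_theorem_of_calculus_interior_strong[OF \<open>finite S\<close>])
      (use st in \<open>auto intro!: der continuous_on_subset[OF u]\<close>)
  then have "(g has_integral u t - u s) ?J" by (simp add: has_integral_Icc_iff_Ioo)
  then have ut: "(LINT x:?J|lborel. w x) = u t - u s"
    unfolding gw[symmetric] by (subst set_borel_integral_eq_integral(2)[OF gJ(1)]) (rule integral_unique)
  interpret J: finite_measure "restrict_space lborel ?J" by (rule finite_measure_interval)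
  have sqI: "set_integrable lborel ?I (\<lambda>t. (norm (w t))\<^sup>2)"
    using w unfolding has_weak_deriv_def in_Lp_2_iff by (simp add: set_integrable_eq)
  then have sqJ: "set_integrable lborel ?J (\<lambda>t. (norm (w t))\<^sup>2)"
    by (rule set_integrable_subset) (use st in auto)
  have wm: "w \<in> borel_measurable (restrict_space lborel ?J)"
    using gJ(2) by (simp add: set_integrable_eq)
  have "(norm (u t - u s))\<^sup>2 \<le> (t - s) * (LINT t:?J|lborel. (norm (w t))\<^sup>2)"
    using J.norm_integral_sq_le[OF wm] sqJ st
    by (simp add: set_integrable_eq LINT_interval_eq[symmetric] ut measure_restrict_space space_restrict_space)
  also have "\<dots> \<le> (t - s) * (LINT t:?I|lborel. (norm (w t))\<^sup>2)"
    using st sqI sqJ unfolding set_lebesgue_integral_def set_integrable_def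
    by (intro mult_left_mono integral_mono) (auto simp: indicator_def)
  finally show ?thesis .
qed

section \<open>Linear interpolants\<close>

text \<open>The floor in the definition selects half-open cells. At the right end it jumps to n + 1,
  but both formulas give \<open>x (n + 1)\<close> there, so the closed cell is allowed.\<close>

lemma linear_interpolant_eq:
  assumes "0 < \<eta>" "t \<in> {of_int n * \<eta>..of_int (n + 1) * \<eta>}"
  shows "linear_interpolant \<eta> x t = x n + (t / \<eta> - of_int n) *\<^sub>R (x (n + 1) - x n)"
proof (cases "t = of_int (n + 1) * \<eta>")
  case True
  then have "t / \<eta> = of_int (n + 1)" using assms by simp
  then show ?thesis by (simp add: linear_interpolant_def)
next
  case False
  then have "\<lfloor>t / \<eta>\<rfloor> = n"
    using assms by (intro floor_unique) (auto simp: field_simps)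
  then show ?thesis by (simp add: linear_interpolant_def Let_def)
qed

lemma continuous_on_linear_interpolant:
  fixes x :: "int \<Rightarrow> 'a::real_normed_vector"
  assumes "0 < \<eta>"
  shows "continuous_on {0..real N * \<eta>} (linear_interpolant \<eta> x)"
proof (induction N)
  case (Suc N)
  have "continuous_on {real N * \<eta>..real (Suc N) * \<eta>} (linear_interpolant \<eta> x)"
  proof (rule continuous_on_eq)
    show "continuous_on {real N * \<eta>..real (Suc N) * \<eta>}
        (\<lambda>t. x (int N) + (t / \<eta> - of_int (int N)) *\<^sub>R (x (int N + 1) - x (int N)))"
      using assms by (intro continuous_intros) auto
    show "x (int N) + (t / \<eta> - of_int (int N)) *\<^sub>R (x (int N + 1) - x (int N)) = linear_interpolant \<eta> x t"
      if "t \<in> {real N * \<eta>..real (Suc N) * \<eta>}" for t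
      using that by (intro linear_interpolant_eq[symmetric] assms) (auto simp: add.commute)
  qed
  then have "continuous_on ({0..real N * \<eta>} \<union> {real N * \<eta>..real (Suc N) * \<eta>}) (linear_interpolant \<eta> x)"
    using Suc by (intro continuous_on_closed_Un) auto
  also have "{0..real N * \<eta>} \<union> {real N * \<eta>..real (Suc N) * \<eta>} = {0..real (Suc N) * \<eta>}"
    using assms by (intro ivl_disj_un_two_touch) (auto intro: mult_right_mono)
  finally show ?case .
qed simp

lemma norm_linear_interpolant_le:
  assumes "0 < \<eta>" "0 \<le> t" "\<And>n. 0 \<le> n \<Longrightarrow> norm (x n) \<le> B"
  shows "norm (linear_interpolant \<eta> x t) \<le> B"
proof -
  define n where "n = \<lfloor>t / \<eta>\<rfloor>"
  define \<theta> where "\<theta> = t / \<eta> - of_int n"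
  have n: "0 \<le> n" using assms by (simp add: n_def)
  have \<theta>: "0 \<le> \<theta>" "\<theta> \<le> 1" unfolding \<theta>_def n_def by linarith+
  have "linear_interpolant \<eta> x t = (1 - \<theta>) *\<^sub>R x n + \<theta> *\<^sub>R x (n + 1)"
    unfolding linear_interpolant_def Let_def n_def[symmetric] \<theta>_def[symmetric] by (simp add: algebra_simps)
  also have "norm \<dots> \<le> (1 - \<theta>) * norm (x n) + \<theta> * norm (x (n + 1))"
    using \<theta> by (intro order_trans[OF norm_triangle_ineq]) simp
  also have "\<dots> \<le> (1 - \<theta>) * B + \<theta> * B"
    using \<theta> n assms(3) by (intro add_mono mult_left_mono) auto
  finally show ?thesis by (simp add: algebra_simps)
qed

text \<open>Unlocks the norm bound: \<open>K\<close> controls the derivative selected by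
  \<open>SOME\<close>, which is a genuine weak derivative only once some weak derivative is
  exhibited. The slope \<open>g\<close> is the witness.\<close>

lemma linear_interpolant_weak_deriv:
  fixes x :: "int \<Rightarrow> 'a::euclidean_space"
  assumes \<eta>: "0 < \<eta>" and T: "T = real N * \<eta>" and B: "\<And>n. 0 \<le> n \<Longrightarrow> norm (x n) \<le> B"
    and K: "H1_norm 0 T (linear_interpolant \<eta> x) \<le> K"
  obtains w where "has_weak_deriv 0 T (linear_interpolant \<eta> x) w"
    "(LINT t:{0<..<T}|lborel. (norm (w t))\<^sup>2) \<le> K\<^sup>2"
    "\<And>s t. 0 \<le> s \<Longrightarrow> s < t \<Longrightarrow> t \<le> T \<Longrightarrow>
       (norm (linear_interpolant \<eta> x t - linear_interpolant \<eta> x s))\<^sup>2 \<le> (t - s) * K\<^sup>2"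
proof -
  let ?u = "linear_interpolant \<eta> x"
  define g where "g t = (1 / \<eta>) *\<^sub>R (x (\<lfloor>t / \<eta>\<rfloor> + 1) - x \<lfloor>t / \<eta>\<rfloor>)" for t
  \<comment> \<open>The grid nodes, where the slope may jump. \<open>g\<close> takes its value from
    the cell to the right, which matters only on this finite set.\<close>
  define S where "S = (\<lambda>n. real n * \<eta>) ` {..N}"
  have finS: "finite S" by (simp add: S_def)
  have u: "continuous_on {0..T} ?u" unfolding T by (rule continuous_on_linear_interpolant[OF \<eta>])
  have der: "(?u has_vector_derivative g t) (at t)" if t: "t \<in> {0<..<T} - S" for t
  proof -
    define n where "n = \<lfloor>t / \<eta>\<rfloor>"
    have n0: "0 \<le> n" using t \<eta> by (simp add: n_def)
    have le: "of_int n \<le> t / \<eta>" "t / \<eta> < of_int n + 1" unfolding n_def by linarith+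
    have "t / \<eta> < real N" using t \<eta> T by (simp add: field_simps)
    then have "n < int N" using le(1) by linarith
    then have "of_int n * \<eta> \<in> S"
      unfolding S_def using n0 by (intro image_eqI[of _ _ "nat n"]) auto
    then have "t \<noteq> of_int n * \<eta>" using t by auto
    then have lt: "t \<in> {of_int n * \<eta><..<of_int (n + 1) * \<eta>}"
      using le \<eta> by (auto simp: field_simps)
    have "((\<lambda>t. x n + (t / \<eta> - of_int n) *\<^sub>R (x (n + 1) - x n)) has_vector_derivative g t) (at t)"
      using \<eta> unfolding g_def n_def[symmetric]
      by (auto intro!: derivative_eq_intros has_vector_derivative_scaleR simp: has_vector_derivative_def)
    then show ?thesis
      by (rule has_vector_derivative_transform_within_open[OF _ open_greaterThanLessThan lt])
        (use \<eta> in \<open>auto intro!: linear_interpolant_eq[symmetric]\<close>)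
  qed
  have "g \<in> borel_measurable lborel"
  proof -
    have "(\<lambda>n. (1 / \<eta>) *\<^sub>R (x (n + 1) - x n)) \<in> measurable (count_space UNIV) borel" by simp
    moreover have "(\<lambda>t. \<lfloor>t / \<eta>\<rfloor>) \<in> measurable lborel (count_space UNIV)" by measurable
    ultimately show ?thesis unfolding g_def by (rule measurable_compose[rotated])
  qed
  then have gm: "set_borel_measurable lborel {0<..<T} g"
    unfolding set_borel_measurable_def by measurable
  have gb: "norm (g t) \<le> (1 / \<eta>) * (B + B)" if "t \<in> {0<..<T}" for t
    unfolding g_def norm_scaleR using that \<eta>
    by (intro mult_mono order_trans[OF norm_triangle_ineq4] add_mono B) auto
  \<comment> \<open>The returned derivative is the one inside \<open>H1_norm\<close>, not the slope
    \<open>g\<close>, since the bound \<open>K\<close> speaks of this one.\<close>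
  define w where "w = weak_deriv 0 T ?u"
  have T0: "0 \<le> T" using T \<eta> by simp
  have "has_weak_deriv 0 T ?u g" by (rule has_weak_derivI[OF T0 finS u der gm gb])
  then have w: "has_weak_deriv 0 T ?u w"
    unfolding w_def weak_deriv_def
    by (rule someI[of "has_weak_deriv 0 T ?u"])
  have wK: "(LINT t:{0<..<T}|lborel. (norm (w t))\<^sup>2) \<le> K\<^sup>2"
  proof -
    have nn: "0 \<le> (LINT t:{0<..<T}|lborel. (norm (f t))\<^sup>2)" for f :: "real \<Rightarrow> 'a"
      unfolding LINT_interval_eq by simp
    have "0 \<le> H1_norm 0 T ?u" unfolding H1_norm_def by (intro real_sqrt_ge_zero add_nonneg_nonneg nn)
    then have "(H1_norm 0 T ?u)\<^sup>2 \<le> K\<^sup>2" using K by (intro power_mono)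
    then show ?thesis
      unfolding H1_norm_def w_def[symmetric] using nn[of ?u] nn[of w] by simp
  qed
  show ?thesis
  proof (rule that[OF w wK])
    fix s t assume st: "0 \<le> s" "s < t" "t \<le> T"
    have "(norm (?u t - ?u s))\<^sup>2 \<le> (t - s) * (LINT t:{0<..<T}|lborel. (norm (w t))\<^sup>2)"
      by (rule Holder_of_weak_deriv[OF finS u der gm gb w st])
    also have "\<dots> \<le> (t - s) * K\<^sup>2" using st wK by (intro mult_left_mono) auto
    finally show "(norm (?u t - ?u s))\<^sup>2 \<le> (t - s) * K\<^sup>2" .
  qed
qed

section \<open>Convergence of the discrete averages\<close>

text \<open>This tail is the exact denominator of the discrete average: the factor h cancels against
  the 1/h in the kernel, and starting the sum at j = 1 drops the cell [0,h).\<close>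

definition kernel_mass :: "(real \<Rightarrow> real) \<Rightarrow> real \<Rightarrow> real" where
  "kernel_mass \<rho> \<eta> = (LINT a:{\<eta>..}|lborel. \<rho> a)"

text \<open>Bounds the numerator of the discrete average when the trajectory at age a has norm at
  most A + B a.\<close>

definition kernel_moment :: "(real \<Rightarrow> real) \<Rightarrow> real \<Rightarrow> real \<Rightarrow> real" where
  "kernel_moment \<rho> A B = (LINT a:{0..}|lborel. (A + B * a) * \<rho> a)"

lemma kernel_continuous_on:
  assumes "admissible_kernel \<rho> \<zeta>" shows "continuous_on {0..} \<rho>"
  using assms unfolding admissible_kernel_def by (blast intro: lipschitz_on_continuous_on)

lemma kernel_integrable:
  assumes k: "admissible_kernel \<rho> \<zeta>"
  shows "set_integrable lborel {0..} (\<lambda>a. (A + B * a) * \<rho> a)"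
proof (rule set_integrable_bound)
  show "set_integrable lborel {0..} (\<lambda>a. (\<bar>A\<bar> + \<bar>B\<bar>) * ((1 + a)\<^sup>2 * \<rho> a))"
    using k unfolding admissible_kernel_def by auto
  show "set_borel_measurable lborel {0..} (\<lambda>a. (A + B * a) * \<rho> a)"
    by (intro set_borel_measurable_continuous_on continuous_intros kernel_continuous_on[OF k]) auto
  show "AE a\<in>{0..} in lborel. norm ((A + B * a) * \<rho> a) \<le> norm ((\<bar>A\<bar> + \<bar>B\<bar>) * ((1 + a)\<^sup>2 * \<rho> a))"
  proof (intro AE_I2 impI)
    fix a :: real assume "a \<in> {0..}"
    then have a: "0 \<le> a" and \<rho>: "0 \<le> \<rho> a" using k by (auto simp: admissible_kernel_def)
    have "1 \<le> (1 + a)\<^sup>2" "a \<le> (1 + a)\<^sup>2" using a by (auto simp: power2_eq_square algebra_simps)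
    then have "\<bar>A\<bar> * 1 + \<bar>B\<bar> * a \<le> \<bar>A\<bar> * (1 + a)\<^sup>2 + \<bar>B\<bar> * (1 + a)\<^sup>2"
      by (intro add_mono mult_left_mono) auto
    moreover have "\<bar>A + B * a\<bar> \<le> \<bar>A\<bar> * 1 + \<bar>B\<bar> * a"
      using a abs_triangle_ineq[of A "B * a"] by (simp add: abs_mult)
    ultimately have "\<bar>A + B * a\<bar> \<le> (\<bar>A\<bar> + \<bar>B\<bar>) * (1 + a)\<^sup>2" by (simp add: algebra_simps)
    then have "\<bar>A + B * a\<bar> * \<rho> a \<le> (\<bar>A\<bar> + \<bar>B\<bar>) * (1 + a)\<^sup>2 * \<rho> a"
      using \<rho> by (rule mult_right_mono)
    then show "norm ((A + B * a) * \<rho> a) \<le> norm ((\<bar>A\<bar> + \<bar>B\<bar>) * ((1 + a)\<^sup>2 * \<rho> a))"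
      using \<rho> by (simp add: abs_mult mult.assoc)
  qed
qed

text \<open>Integrand that turns the sum over cells into an integral over ages: for a in [j\<eta>,
  (j+1)\<eta>) the floor is j, so the j-th past value is weighted by the kernel itself.\<close>

definition delayed_step ::
  "(real \<Rightarrow> real) \<Rightarrow> real \<Rightarrow> (int \<Rightarrow> 'a::euclidean_space) \<Rightarrow> int \<Rightarrow> real \<Rightarrow> 'a" where
  "delayed_step \<rho> \<eta> y n a = \<rho> a *\<^sub>R y (n - \<lfloor>a / \<eta>\<rfloor>)"

lemma norm_delayed_step_le:
  assumes k: "admissible_kernel \<rho> \<zeta>" and "0 < \<eta>" "0 \<le> B" "0 \<le> a"
    and y: "\<And>j. norm (y (n - int j)) \<le> A + B * (real j * \<eta>)"
  shows "norm (delayed_step \<rho> \<eta> y n a) \<le> (A + B * a) * \<rho> a"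
proof -
  have j: "0 \<le> \<lfloor>a / \<eta>\<rfloor>" using assms by simp
  have "real_of_int \<lfloor>a / \<eta>\<rfloor> * \<eta> \<le> a"
    using \<open>0 < \<eta>\<close> by (rule floor_divide_lower)
  then have "A + B * (real (nat \<lfloor>a / \<eta>\<rfloor>) * \<eta>) \<le> A + B * a"
    using j \<open>0 \<le> B\<close> by (intro add_left_mono mult_left_mono) auto
  then have "norm (y (n - \<lfloor>a / \<eta>\<rfloor>)) \<le> A + B * a"
    using y[of "nat \<lfloor>a / \<eta>\<rfloor>"] j by simp
  moreover have "0 \<le> \<rho> a" using k \<open>0 \<le> a\<close> by (auto simp: admissible_kernel_def)
  ultimately show ?thesis
    unfolding delayed_step_def by (simp add: mult_right_mono mult.commute[of "\<rho> a"])
qed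

lemma delayed_step_measurable:
  assumes k: "admissible_kernel \<rho> \<zeta>" and "A \<in> sets borel" "A \<subseteq> {0..}"
  shows "set_borel_measurable lborel A (delayed_step \<rho> \<eta> y n)"
  unfolding delayed_step_def
proof (rule set_borel_measurable_scaleR)
  show "set_borel_measurable lborel A \<rho>"
    using assms by (intro set_borel_measurable_continuous_on continuous_on_subset[OF kernel_continuous_on[OF k]])
  have "(\<lambda>j. y (n - j)) \<in> measurable (count_space UNIV) borel" by simp
  moreover have "(\<lambda>a. \<lfloor>a / \<eta>\<rfloor>) \<in> measurable lborel (count_space UNIV)" by measurable
  ultimately have [measurable]: "(\<lambda>a. y (n - \<lfloor>a / \<eta>\<rfloor>)) \<in> borel_measurable lborel"
    by (rule measurable_compose[rotated])
  show "set_borel_measurable lborel A (\<lambda>a. y (n - \<lfloor>a / \<eta>\<rfloor>))"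
    using assms(2) unfolding set_borel_measurable_def by measurable
qed

lemma delayed_step_integrable:
  assumes k: "admissible_kernel \<rho> \<zeta>" and "0 < \<eta>" "0 \<le> B"
    and y: "\<And>j. norm (y (n - int j)) \<le> A + B * (real j * \<eta>)"
  shows "set_integrable lborel {0..} (delayed_step \<rho> \<eta> y n)"
proof (rule set_integrable_bound[OF kernel_integrable[OF k, of A B]])
  show "AE a\<in>{0..} in lborel. norm (delayed_step \<rho> \<eta> y n a) \<le> norm ((A + B * a) * \<rho> a)"
    using norm_delayed_step_le[OF k assms(2,3) _ y] by (intro AE_I2) fastforce
qed (rule delayed_step_measurable[OF k]; simp)

text \<open>Half-open cells tile the half-line from \<eta> without overlap; the closed cells used by
  \<open>discrete_kernel\<close> differ from them by one point each, a null set.\<close>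

lemma LINT_shifted_cells:
  fixes f :: "real \<Rightarrow> 'a::euclidean_space"
  assumes "0 < \<eta>" and int: "set_integrable lborel {0..} f"
  shows "(\<Sum>i. LINT a:{real (i + 1) * \<eta>..real (i + 2) * \<eta>}|lborel. f a) = (LINT a:{\<eta>..}|lborel. f a)"
proof -
  let ?A = "\<lambda>i. {real (i + 1) * \<eta>..<real (i + 2) * \<eta>}"
  have disj: "?A i \<inter> ?A j = {}" if "i \<noteq> j" for i j
  proof -
    have "?A i \<inter> ?A j = {}" if "i < j" for i j
    proof -
      have "real (i + 2) * \<eta> \<le> real (j + 1) * \<eta>" using that \<open>0 < \<eta>\<close> by (intro mult_right_mono) auto
      then show ?thesis by auto
    qed
    then show ?thesis using that by (metis Int_commute nat_neq_iff)
  qed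
  have "(\<Union>i. ?A i) = {\<eta>..}"
  proof (intro set_eqI iffI)
    fix a assume "a \<in> (\<Union>i. ?A i)"
    then obtain i where "real (i + 1) * \<eta> \<le> a" by auto
    moreover have "1 * \<eta> \<le> real (i + 1) * \<eta>" using \<open>0 < \<eta>\<close> by (intro mult_right_mono) auto
    ultimately show "a \<in> {\<eta>..}" by simp
  next
    fix a assume a: "a \<in> {\<eta>..}"
    then have "1 \<le> a / \<eta>" using \<open>0 < \<eta>\<close> by simp
    then have 1: "1 \<le> \<lfloor>a / \<eta>\<rfloor>" by simp
    have "real_of_int \<lfloor>a / \<eta>\<rfloor> * \<eta> \<le> a" "a < (real_of_int \<lfloor>a / \<eta>\<rfloor> + 1) * \<eta>"
      by (intro floor_divide_lower floor_divide_upper \<open>0 < \<eta>\<close>)+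
    then have "a \<in> ?A (nat (\<lfloor>a / \<eta>\<rfloor> - 1))"
      using 1 by (simp add: of_nat_diff nat_diff_distrib algebra_simps)
    then show "a \<in> (\<Union>i. ?A i)" by blast
  qed
  moreover have "set_integrable lborel {\<eta>..} f"
    by (rule set_integrable_subset[OF int]) (use \<open>0 < \<eta>\<close> in auto)
  ultimately have sum: "(LINT a:{\<eta>..}|lborel. f a) = (\<Sum>i. LINT a:?A i|lborel. f a)"
    using lebesgue_integral_countable_add[of ?A lborel f] disj by simp
  have "(LINT a:?A i|lborel. f a) = (LINT a:{real (i + 1) * \<eta>..real (i + 2) * \<eta>}|lborel. f a)" for i
    by (rule set_integral_discrete_difference[where X = "{real (i + 2) * \<eta>}"]) auto
  then show ?thesis by (simp only: sum)
qed

text \<open>An exact identity without quadrature error, because the discrete kernel consists of cell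
  means and the delayed index is constant on a cell. Linear growth of \<open>y\<close> into the past
  gives the integrability behind the series.\<close>

lemma discrete_average_eq:
  fixes y :: "int \<Rightarrow> 'a::euclidean_space"
  assumes k: "admissible_kernel \<rho> \<zeta>" and \<eta>: "0 < \<eta>" and B: "0 \<le> B"
    and y: "\<And>j. norm (y (n - int j)) \<le> A + B * (real j * \<eta>)"
  shows "discrete_average \<rho> \<eta> y n = (LINT a:{\<eta>..}|lborel. delayed_step \<rho> \<eta> y n a) /\<^sub>R kernel_mass \<rho> \<eta>"
proof -
  have i\<rho>: "set_integrable lborel {0..} \<rho>" using kernel_integrable[OF k, of 1 0] by simp
  have i: "set_integrable lborel {0..} (delayed_step \<rho> \<eta> y n)"
    by (rule delayed_step_integrable[OF k \<eta> B y])
  have cell: "discrete_kernel \<rho> \<eta> (i + 1) *\<^sub>R y (n - int (i + 1))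
      = (LINT a:{real (i + 1) * \<eta>..real (i + 2) * \<eta>}|lborel. (1 / \<eta>) *\<^sub>R delayed_step \<rho> \<eta> y n a)" for i
  proof -
    let ?c = "{real (i + 1) * \<eta>..<real (i + 2) * \<eta>}"
    have c0: "?c \<subseteq> {0..}" using \<eta> by (auto intro: order_trans[rotated])
    have borel_cell: "?c \<in> sets lborel" by simp
    have eq: "delayed_step \<rho> \<eta> y n a = \<rho> a *\<^sub>R y (n - int (i + 1))" if "a \<in> ?c" for a
    proof -
      have "\<lfloor>a / \<eta>\<rfloor> = int (i + 1)" using that \<eta> by (intro floor_unique) (auto simp: field_simps)
      then show ?thesis by (simp add: delayed_step_def)
    qed
    have "(LINT a:{real (i + 1) * \<eta>..real (i + 2) * \<eta>}|lborel. (1 / \<eta>) *\<^sub>R delayed_step \<rho> \<eta> y n a)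
        = (LINT a:?c|lborel. (1 / \<eta>) *\<^sub>R delayed_step \<rho> \<eta> y n a)"
      by (rule set_integral_discrete_difference[where X = "{real (i + 2) * \<eta>}"]) auto
    also have "\<dots> = (1 / \<eta>) *\<^sub>R (LINT a:?c|lborel. delayed_step \<rho> \<eta> y n a)" by simp
    also have "(LINT a:?c|lborel. delayed_step \<rho> \<eta> y n a) = (LINT a:?c|lborel. \<rho> a *\<^sub>R y (n - int (i + 1)))"
      by (rule set_lebesgue_integral_cong) (use eq in auto)
    also have "\<dots> = (LINT a:?c|lborel. \<rho> a) *\<^sub>R y (n - int (i + 1))"
      using set_integrable_subset[OF i\<rho> borel_cell c0]
      unfolding set_lebesgue_integral_def set_integrable_def
      by (simp only: scaleR_scaleR real_scaleR_def integral_scaleR_left)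
    also have "(LINT a:?c|lborel. \<rho> a) = (LINT a:{real (i + 1) * \<eta>..real (i + 1 + 1) * \<eta>}|lborel. \<rho> a)"
      by (rule set_integral_discrete_difference[where X = "{real (i + 2) * \<eta>}"]) auto
    finally show ?thesis by (simp add: discrete_kernel_def)
  qed
  have "(\<Sum>i. discrete_kernel \<rho> \<eta> (i + 1) *\<^sub>R y (n - int (i + 1)))
      = (1 / \<eta>) *\<^sub>R (LINT a:{\<eta>..}|lborel. delayed_step \<rho> \<eta> y n a)"
    unfolding cell using LINT_shifted_cells[OF \<eta>, of "\<lambda>a. (1 / \<eta>) *\<^sub>R delayed_step \<rho> \<eta> y n a"] i by simp
  moreover have "(\<Sum>i. discrete_kernel \<rho> \<eta> (i + 1)) = (1 / \<eta>) * kernel_mass \<rho> \<eta>"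
    using LINT_shifted_cells[OF \<eta>, of "\<lambda>a. (1 / \<eta>) * \<rho> a"] i\<rho> \<eta>
    by (simp add: discrete_kernel_def kernel_mass_def add.commute)
  ultimately show ?thesis using \<eta> by (simp add: discrete_average_def)
qed

lemma kernel_mass_nonneg:
  assumes "admissible_kernel \<rho> \<zeta>" "0 \<le> \<eta>"
  shows "0 \<le> kernel_mass \<rho> \<eta>"
  unfolding kernel_mass_def set_lebesgue_integral_def
  using assms by (intro integral_nonneg_AE AE_I2) (auto simp: admissible_kernel_def indicator_def)

text \<open>Only nonnegativity of the mass is invoked: were it zero, both sides would be 0, as
  \<open>inverse 0 = 0\<close>.\<close>

lemma norm_discrete_average_le:
  fixes y :: "int \<Rightarrow> 'a::euclidean_space"
  assumes k: "admissible_kernel \<rho> \<zeta>" and \<eta>: "0 < \<eta>" and B: "0 \<le> B"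
    and y: "\<And>j. norm (y (n - int j)) \<le> A + B * (real j * \<eta>)"
  shows "norm (discrete_average \<rho> \<eta> y n) \<le> inverse (kernel_mass \<rho> \<eta>) * kernel_moment \<rho> A B"
proof -
  have i0: "set_integrable lborel {0..} (delayed_step \<rho> \<eta> y n)"
    by (rule delayed_step_integrable[OF k \<eta> B y])
  have i: "set_integrable lborel {\<eta>..} (delayed_step \<rho> \<eta> y n)"
    by (rule set_integrable_subset[OF i0]) (use \<eta> in auto)
  have "norm (LINT a:{\<eta>..}|lborel. delayed_step \<rho> \<eta> y n a) \<le> kernel_moment \<rho> A B"
    unfolding set_lebesgue_integral_def kernel_moment_def
  proof (rule Bochner_Integration.integral_norm_bound_integral)
    show "norm (indicator {\<eta>..} a *\<^sub>R delayed_step \<rho> \<eta> y n a) \<le> indicator {0..} a *\<^sub>R ((A + B * a) * \<rho> a)" for a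
      using norm_delayed_step_le[OF k \<eta> B _ y, of a] \<eta>
      by (auto simp: indicator_def intro: order_trans[OF norm_ge_zero])
  qed (use i kernel_integrable[OF k, of A B] in \<open>auto simp: set_integrable_def\<close>)
  then show ?thesis
    unfolding discrete_average_eq[OF k \<eta> B y] norm_scaleR
    using kernel_mass_nonneg[OF k, of \<eta>] \<eta> by (simp add: mult_left_mono)
qed

text \<open>Dominated convergence with a moving lower limit. A positive age is eventually above
  \<eta>, so the truncation disappears in the limit; age 0 and the countable set \<open>S\<close>
  are negligible.\<close>

lemma LINT_delay_tendsto:
  fixes f :: "nat \<Rightarrow> real \<Rightarrow> 'a::euclidean_space"
  assumes \<eta>: "\<eta> \<longlonglongrightarrow> 0" "\<And>k. 0 < \<eta> k" and "countable S"
    and f: "\<And>k. set_borel_measurable lborel {0..} (f k)" and g: "set_borel_measurable lborel {0..} g"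
    and w: "set_integrable lborel {0..} w" "\<And>k a. 0 \<le> a \<Longrightarrow> norm (f k a) \<le> w a"
    and lim: "\<And>a. 0 < a \<Longrightarrow> a \<notin> S \<Longrightarrow> (\<lambda>k. f k a) \<longlonglongrightarrow> g a"
  shows "(\<lambda>k. LINT a:{\<eta> k..}|lborel. f k a) \<longlonglongrightarrow> (LINT a:{0..}|lborel. g a)"
  unfolding set_lebesgue_integral_def
proof (rule integral_dominated_convergence[where w = "\<lambda>a. indicator {0..} a *\<^sub>R w a"])
  show "(\<lambda>a. indicator {\<eta> k..} a *\<^sub>R f k a) \<in> borel_measurable lborel" for k
    using set_borel_measurable_subset[OF f, of "{\<eta> k..}" k] \<eta>(2)[of k] unfolding set_borel_measurable_def by auto
  have "AE a in lborel. a \<notin> insert 0 S"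
    using AE_lborel_singleton countable_imp_null_set_lborel[of "insert 0 S"] \<open>countable S\<close>
    by (intro AE_not_in) auto
  then show "AE a in lborel. (\<lambda>k. indicator {\<eta> k..} a *\<^sub>R f k a) \<longlonglongrightarrow> indicator {0..} a *\<^sub>R g a"
  proof eventually_elim
    case (elim a)
    show ?case
    proof (cases "a < 0")
      case True
      then have "indicator {\<eta> k..} a *\<^sub>R f k a = 0" for k using \<eta>(2)[of k] by (simp add: indicator_def)
      then show ?thesis using True by (simp del: scaleR_eq_0_iff)
    next
      case False
      then have a: "0 < a" "a \<notin> S" using elim by auto
      have "\<forall>\<^sub>F k in sequentially. \<eta> k < a" by (rule order_tendstoD(2)[OF \<eta>(1) a(1)])
      then have "\<forall>\<^sub>F k in sequentially. f k a = indicator {\<eta> k..} a *\<^sub>R f k a"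
        by eventually_elim simp
      then have "(\<lambda>k. indicator {\<eta> k..} a *\<^sub>R f k a) \<longlonglongrightarrow> g a"
        by (rule Lim_transform_eventually[OF lim[OF a]])
      then show ?thesis using a by simp
    qed
  qed
  show "AE a in lborel. norm (indicator {\<eta> k..} a *\<^sub>R f k a) \<le> indicator {0..} a *\<^sub>R w a" for k
  proof (rule AE_I2)
    fix a
    show "norm (indicator {\<eta> k..} a *\<^sub>R f k a) \<le> indicator {0..} a *\<^sub>R w a"
      using w(2)[of a k] \<eta>(2)[of k] order_trans[OF norm_ge_zero w(2)[of a k]]
      by (auto simp: indicator_def)
  qed
qed (use g w(1) in \<open>auto simp: set_borel_measurable_def set_integrable_def\<close>)

lemma kernel_mass_tendsto:
  assumes k: "admissible_kernel \<rho> \<zeta>" and \<eta>: "\<eta> \<longlonglongrightarrow> 0" "\<And>k. 0 < \<eta> k"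
  shows "(\<lambda>k. kernel_mass \<rho> (\<eta> k)) \<longlonglongrightarrow> 1"
proof -
  have "set_borel_measurable lborel {0..} \<rho>"
    by (intro set_borel_measurable_continuous_on kernel_continuous_on[OF k]) auto
  moreover have "norm (\<rho> a) \<le> \<rho> a" if "0 \<le> a" for a using k that by (auto simp: admissible_kernel_def)
  ultimately have "(\<lambda>k. kernel_mass \<rho> (\<eta> k)) \<longlonglongrightarrow> (LINT a:{0..}|lborel. \<rho> a)"
    unfolding kernel_mass_def using kernel_integrable[OF k, of 1 0]
    by (intro LINT_delay_tendsto[OF \<eta>, where S = "{}" and w = \<rho>]) auto
  then show ?thesis using k by (simp add: admissible_kernel_def)
qed

text \<open>The hypothesis \<open>conv\<close> quantifies over all index sequences with grid times
  tending to s, because it is applied to n minus the rounded age, whose time tends to t - a by an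
  error of order \<eta>. The exclusion s \<noteq> 0 costs the single age a = t, and a > 0 gives s <
  t.\<close>

lemma discrete_average_tendsto:
  fixes y :: "nat \<Rightarrow> int \<Rightarrow> 'a::euclidean_space"
  assumes k: "admissible_kernel \<rho> \<zeta>" and \<eta>: "\<eta> \<longlonglongrightarrow> 0" "\<And>k. 0 < \<eta> k" and B: "0 \<le> B"
    and y: "\<And>k j. norm (y k (n k - int j)) \<le> A + B * (real j * \<eta> k)"
    and n: "(\<lambda>k. of_int (n k) * \<eta> k) \<longlonglongrightarrow> t"
    and Z: "Z \<in> borel_measurable borel"
    and conv: "\<And>s m. s < t \<Longrightarrow> s \<noteq> 0 \<Longrightarrow> (\<lambda>k. of_int (m k) * \<eta> k) \<longlonglongrightarrow> s \<Longrightarrow> (\<lambda>k. y k (m k)) \<longlonglongrightarrow> Z s"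
  shows "(\<lambda>k. discrete_average \<rho> (\<eta> k) (y k) (n k)) \<longlonglongrightarrow> (LINT a:{0..}|lborel. \<rho> a *\<^sub>R Z (t - a))"
proof -
  have step: "(\<lambda>k. delayed_step \<rho> (\<eta> k) (y k) (n k) a) \<longlonglongrightarrow> \<rho> a *\<^sub>R Z (t - a)"
    if a: "0 < a" "a \<notin> {t}" for a
  proof -
    have "(\<lambda>k. of_int \<lfloor>a / \<eta> k\<rfloor> * \<eta> k - a) \<longlonglongrightarrow> 0"
    proof (rule Lim_null_comparison[OF _ \<eta>(1)], intro always_eventually allI)
      fix k
      have "of_int \<lfloor>a / \<eta> k\<rfloor> * \<eta> k \<le> a" "a < (of_int \<lfloor>a / \<eta> k\<rfloor> + 1) * \<eta> k"
        by (intro floor_divide_lower floor_divide_upper \<eta>(2))+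
      then show "norm (of_int \<lfloor>a / \<eta> k\<rfloor> * \<eta> k - a) \<le> \<eta> k" by (simp add: algebra_simps)
    qed
    then have "(\<lambda>k. of_int \<lfloor>a / \<eta> k\<rfloor> * \<eta> k) \<longlonglongrightarrow> a" by (rule LIM_zero_cancel)
    from tendsto_diff[OF n this] have "(\<lambda>k. of_int (n k - \<lfloor>a / \<eta> k\<rfloor>) * \<eta> k) \<longlonglongrightarrow> t - a"
      by (simp add: left_diff_distrib)
    then show ?thesis unfolding delayed_step_def using a by (intro tendsto_intros conv) auto
  qed
  have "set_borel_measurable lborel {0..} (\<lambda>a. \<rho> a *\<^sub>R Z (t - a))"
  proof (rule set_borel_measurable_scaleR)
    show "set_borel_measurable lborel {0..} \<rho>"
      by (intro set_borel_measurable_continuous_on kernel_continuous_on[OF k]) auto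
    have "(\<lambda>a. Z (t - a)) \<in> borel_measurable borel"
      by (rule measurable_compose[OF _ Z]) measurable
    then show "set_borel_measurable lborel {0..} (\<lambda>a. Z (t - a))"
      unfolding set_borel_measurable_def by measurable
  qed
  then have "(\<lambda>k. LINT a:{\<eta> k..}|lborel. delayed_step \<rho> (\<eta> k) (y k) (n k) a) \<longlonglongrightarrow> (LINT a:{0..}|lborel. \<rho> a *\<^sub>R Z (t - a))"
    by (intro LINT_delay_tendsto[OF \<eta>, where S = "{t}" and w = "\<lambda>a. (A + B * a) * \<rho> a"] step
          delayed_step_measurable[OF k] kernel_integrable[OF k] norm_delayed_step_le[OF k \<eta>(2) B _ y]) auto
  then have "(\<lambda>k. (LINT a:{\<eta> k..}|lborel. delayed_step \<rho> (\<eta> k) (y k) (n k) a) /\<^sub>R kernel_mass \<rho> (\<eta> k))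
      \<longlonglongrightarrow> (LINT a:{0..}|lborel. \<rho> a *\<^sub>R Z (t - a)) /\<^sub>R 1"
    by (intro tendsto_intros kernel_mass_tendsto[OF k \<eta>]) auto
  then show ?thesis by (simp add: discrete_average_eq[OF k \<eta>(2) B y])
qed

section \<open>Projections on moving convex sets\<close>

text \<open>Boundedness makes the real supremum in \<open>hausdorff_dist\<close> a true upper bound,
  since it bounds the distances over which the supremum is taken.\<close>

lemma infdist_le_hausdorff_dist:
  assumes "bounded A" "bounded B" "B \<noteq> {}" "x \<in> A"
  shows "infdist x B \<le> hausdorff_dist A B"
proof -
  obtain b where b: "b \<in> B" using assms by auto
  obtain e where e: "\<And>a. a \<in> A \<Longrightarrow> dist b a \<le> e" using \<open>bounded A\<close> by (meson bounded_any_center)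
  have "bdd_above ((\<lambda>x. infdist x B) ` A)"
    by (rule bdd_aboveI2[where M = e]) (use b e in \<open>auto intro!: infdist_le2 simp: dist_commute\<close>)
  then have "infdist x B \<le> (SUP x\<in>A. infdist x B)" using \<open>x \<in> A\<close> by (rule cSUP_upper2) simp
  then show ?thesis by (simp add: hausdorff_dist_def)
qed

lemma hausdorff_dist_commute: "hausdorff_dist A B = hausdorff_dist B A"
  by (simp add: hausdorff_dist_def max.commute)

text \<open>Each half of the Hausdorff distance has its task: one puts the limit \<open>p0\<close>
  into \<open>E\<close>, the other approximates every competitor in \<open>E\<close> by points of
  \<open>D k\<close>, so that the variational inequality survives the limit.\<close>

lemma closest_point_limit:
  fixes z :: "nat \<Rightarrow> 'a::euclidean_space"
  assumes D: "\<And>k. closed (D k)" "\<And>k. convex (D k)" "\<And>k. D k \<noteq> {}" "\<And>k. bounded (D k)"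
    and E: "closed E" "convex E" "E \<noteq> {}" "bounded E"
    and DE: "(\<lambda>k. hausdorff_dist (D k) E) \<longlonglongrightarrow> 0"
    and z: "z \<longlonglongrightarrow> z0" and p: "(\<lambda>k. closest_point (D k) (z k)) \<longlonglongrightarrow> p0"
  shows "z0 - p0 \<in> normal_cone E p0" "p0 = closest_point E z0"
proof -
  define p where "p k = closest_point (D k) (z k)" for k
  have p_in: "p k \<in> D k" for k unfolding p_def by (intro closest_point_in_set D)
  have p_lim: "p \<longlonglongrightarrow> p0" using p by (simp add: p_def[abs_def])
  have "(\<lambda>k. infdist (p k) E) \<longlonglongrightarrow> 0"
    by (rule Lim_null_comparison[OF _ DE])
      (use infdist_le_hausdorff_dist[OF D(4) E(4,3) p_in] in \<open>auto intro!: always_eventually simp: infdist_nonneg\<close>)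
  then have "infdist p0 E = 0"
    using LIMSEQ_unique tendsto_infdist[OF p_lim] by blast
  then have p0: "p0 \<in> E" using E in_closed_iff_infdist_zero by blast
  have ineq: "(z0 - p0) \<bullet> (y - p0) \<le> 0" if y: "y \<in> E" for y
  proof -
    \<comment> \<open>The inequality for \<open>p k\<close> may be tested only with points of
      \<open>D k\<close>; the projection of \<open>y\<close> is such a point and lies within the
      Hausdorff distance of \<open>y\<close>.\<close>
    define q where "q k = closest_point (D k) y" for k
    have q_in: "q k \<in> D k" for k unfolding q_def by (intro closest_point_in_set D)
    have "(\<lambda>k. q k - y) \<longlonglongrightarrow> 0"
    proof (rule Lim_null_comparison[OF _ DE], intro always_eventually allI)
      fix k
      obtain b where "b \<in> D k" "infdist y (D k) = dist y b"
        using infdist_attains_inf[OF D(1,3)] by blast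
      then have "dist y (q k) \<le> infdist y (D k)"
        unfolding q_def using closest_point_le[OF D(1)] by metis
      also have "\<dots> \<le> hausdorff_dist (D k) E"
        using infdist_le_hausdorff_dist[OF E(4) D(4,3) y] by (simp add: hausdorff_dist_commute)
      finally show "norm (q k - y) \<le> hausdorff_dist (D k) E" by (simp add: dist_norm norm_minus_commute)
    qed
    then have q: "q \<longlonglongrightarrow> y" by (rule LIM_zero_cancel)
    have "(z k - p k) \<bullet> (q k - p k) \<le> 0" for k
      unfolding p_def by (intro closest_point_dot D q_in)
    moreover have "(\<lambda>k. (z k - p k) \<bullet> (q k - p k)) \<longlonglongrightarrow> (z0 - p0) \<bullet> (y - p0)"
      by (intro tendsto_intros z p_lim q)
    ultimately show ?thesis by (intro tendsto_upperbound[where F = sequentially]) auto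
  qed
  show "z0 - p0 \<in> normal_cone E p0" using p0 ineq by (auto simp: normal_cone_def)
  \<comment> \<open>Converse direction: expanding the square around \<open>p0\<close> turns the
    variational inequality into minimality of the distance.\<close>
  have "dist z0 p0 \<le> dist z0 y" if "y \<in> E" for y
  proof -
    have "(norm (z0 - y))\<^sup>2 = (norm (z0 - p0))\<^sup>2 - 2 * ((z0 - p0) \<bullet> (y - p0)) + (norm (y - p0))\<^sup>2"
      by (simp add: power2_norm_eq_inner inner_simps inner_commute)
    then have "(norm (z0 - p0))\<^sup>2 \<le> (norm (z0 - y))\<^sup>2"
      using ineq[OF that] by (smt (verit) zero_le_power2)
    then show ?thesis unfolding dist_norm by (rule power2_le_imp_le) simp
  qed
  then show "p0 = closest_point E z0" using closest_point_unique[OF E(2,1) p0] by blast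
qed

section \<open>Convergence of the sweeping sequence\<close>

text \<open>The reference point is -1 because 0 lies outside the domain of the past datum.\<close>

lemma lipschitz_linear_growth:
  fixes f :: "real \<Rightarrow> 'a::real_normed_vector"
  assumes "L-lipschitz_on {..<0} f" "s < 0"
  shows "norm (f s) \<le> norm (f (- 1)) + L + L * \<bar>s\<bar>"
proof -
  have L: "0 \<le> L" using assms(1) by (rule lipschitz_on_nonneg)
  have "dist (f s) (f (- 1)) \<le> L * dist s (- 1)"
    by (rule lipschitz_onD[OF assms(1)]) (use assms(2) in auto)
  also have "\<dots> \<le> L * (1 + \<bar>s\<bar>)"
    using L by (intro mult_left_mono) (auto simp: dist_real_def)
  finally have "norm (f s - f (- 1)) \<le> L + L * \<bar>s\<bar>" by (simp add: dist_norm algebra_simps)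
  then show ?thesis using norm_triangle_ineq2[of "f s" "f (- 1)"] by linarith
qed

lemma sweeping_seq_in:
  assumes "0 \<le> n" "0 < \<eta>" and C: "\<And>t. 0 \<le> t \<Longrightarrow> closed (C t) \<and> C t \<noteq> {}"
  shows "sweeping_seq \<rho> C Xp \<eta> n \<in> C (of_int n * \<eta>)"
  using assms by (simp add: sweeping_eq_closest_point closest_point_in_set)

text \<open>The ceiling minus one indexes the cell (n\<eta>, (n+1)\<eta>] containing t, as in
  \<open>step_interpolant\<close>, so the grid time is within \<eta> of t.\<close>

lemma ceiling_step_tendsto:
  fixes \<eta> :: "nat \<Rightarrow> real"
  assumes "\<eta> \<longlonglongrightarrow> 0" "\<And>k. 0 < \<eta> k"
  shows "(\<lambda>k. of_int (\<lceil>t / \<eta> k\<rceil> - 1) * \<eta> k) \<longlonglongrightarrow> t"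
proof -
  have "(\<lambda>k. of_int (\<lceil>t / \<eta> k\<rceil> - 1) * \<eta> k - t) \<longlonglongrightarrow> 0"
  proof (rule Lim_null_comparison[OF _ assms(1)], intro always_eventually allI)
    fix k
    have "t \<le> of_int \<lceil>t / \<eta> k\<rceil> * \<eta> k" "(of_int \<lceil>t / \<eta> k\<rceil> - 1) * \<eta> k < t"
      by (intro ceiling_divide_upper ceiling_divide_lower assms(2))+
    then show "norm (of_int (\<lceil>t / \<eta> k\<rceil> - 1) * \<eta> k - t) \<le> \<eta> k"
      by (simp add: left_diff_distrib)
  qed
  then show ?thesis by (rule LIM_zero_cancel)
qed

theorem theorem4:
  fixes \<rho> :: "real \<Rightarrow> real" and \<zeta> T M h0 C0 K :: real
    and Xp :: "real \<Rightarrow> real ^ 'm" and C :: "real \<Rightarrow> (real ^ 'm) set"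
    and h :: "nat \<Rightarrow> real"
  defines "x \<equiv> sweeping_seq \<rho> C Xp"
  defines "Xh \<equiv> \<lambda>\<eta>. linear_interpolant \<eta> (x \<eta>)"
  defines "Xbarh \<equiv> \<lambda>\<eta>. step_interpolant \<eta> (discrete_average \<rho> \<eta> (x \<eta>))"
  assumes "0 < \<zeta>" and "admissible_kernel \<rho> \<zeta>"
    and "\<exists>L. L-lipschitz_on {..<0} Xp"
    and "\<forall>t\<ge>0. closed (C t) \<and> convex (C t) \<and> C t \<noteq> {}"
    and "hausdorff_continuous_on {0..} C"
    and "0 < M" and "\<forall>\<eta>>0. \<forall>n::nat. C (real n * \<eta>) \<subseteq> ball 0 M"
    and "0 < T" and "0 < h0"
    and "\<forall>\<eta>. 0 < \<eta> \<and> \<eta> < h0 \<longrightarrow>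
           (\<Sum>n = 1..nat \<lfloor>T / \<eta>\<rfloor>.
              (hausdorff_dist (C (real n * \<eta>)) (C (real (n - 1) * \<eta>)))\<^sup>2 / \<eta>) \<le> C0"
    and "\<forall>\<eta>. admissible_step T \<eta> \<longrightarrow> H1_norm 0 T (Xh \<eta>) \<le> K"
    and "\<forall>k. admissible_step T (h k)" and "h \<longlonglongrightarrow> 0"
  shows "\<exists>X r. in_H1 0 T X \<and> strict_mono (r :: nat \<Rightarrow> nat)
     \<and> uniform_limit {0..T} (\<lambda>k. Xh (h (r k))) X sequentially
     \<and> (\<forall>p\<ge>1. Lp_convergent p {0<..<T} (\<lambda>k. Xbarh (h (r k))) (delayed_average \<rho> Xp X))
     \<and> (AE t in lborel. t \<in> {0<..<T} \<longrightarrow>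
          delayed_average \<rho> Xp X t - X t \<in> normal_cone (C t) (X t))
     \<and> (AE t in lborel. t \<in> {0<..<T} \<longrightarrow>
          X t = closest_point (C t) (delayed_average \<rho> Xp X t))"
proof -
  note kernel = \<open>admissible_kernel \<rho> \<zeta>\<close>
  obtain L where L: "L-lipschitz_on {..<0} Xp" using assms by blast
  have L0: "0 \<le> L" using L by (rule lipschitz_on_nonneg)
  have Ccl: "closed (C t)" "convex (C t)" "C t \<noteq> {}" if "0 \<le> t" for t
    using assms(7) that by auto
  \<comment> \<open>The ball hypothesis ranges over all steps, so a time t > 0 is reached as step t
    with index 1, and time 0 as index 0.\<close>
  have CM: "C t \<subseteq> ball 0 M" if "0 \<le> t" for t
    using assms(10)[rule_format, of t 1] assms(10)[rule_format, of 1 0] that by (cases "t = 0") auto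
  have CM': "norm z < M" if "z \<in> C t" "0 \<le> t" for z t
    using CM[OF that(2)] that(1) by auto
  have Cbd: "bounded (C t)" if "0 \<le> t" for t using CM[OF that] bounded_ball bounded_subset by blast
  have hpos: "0 < h k" for k using assms by (auto simp: admissible_step_def)
  have hN: "\<exists>N. T = real N * h k" for k
  proof -
    obtain N where "T / h k = real N"
      using assms(15) unfolding admissible_step_def by (meson Nats_cases)
    then have "T = real N * h k" using hpos[of k] by (simp add: field_simps)
    then show ?thesis ..
  qed
  have xM: "norm (x \<eta> n) \<le> M" if "0 < \<eta>" "0 \<le> n" for \<eta> n
  proof -
    have "x \<eta> n \<in> C (of_int n * \<eta>)"
      unfolding x_def by (rule sweeping_seq_in[OF that(2,1)]) (use Ccl in auto)
    then show ?thesis using CM'[of "x \<eta> n" "of_int n * \<eta>"] that by simp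
  qed

  \<comment> \<open>Compactness of the interpolants and regularity of the limit\<close>
  have wd: "\<exists>w. has_weak_deriv 0 T (Xh (h k)) w \<and> (LINT t:{0<..<T}|lborel. (norm (w t))\<^sup>2) \<le> K\<^sup>2
      \<and> (\<forall>s t. 0 \<le> s \<longrightarrow> s < t \<longrightarrow> t \<le> T \<longrightarrow> (norm (Xh (h k) t - Xh (h k) s))\<^sup>2 \<le> (t - s) * K\<^sup>2)" for k
  proof -
    obtain N where N: "T = real N * h k" using hN by blast
    have Kk: "H1_norm 0 T (linear_interpolant (h k) (x (h k))) \<le> K"
      using assms(14,15) unfolding Xh_def by blast
    show ?thesis
      using linear_interpolant_weak_deriv[OF hpos N xM[OF hpos] Kk] unfolding Xh_def by metis
  qed
  then obtain w where w: "\<And>k. has_weak_deriv 0 T (Xh (h k)) (w k)"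
      "\<And>k. (LINT t:{0<..<T}|lborel. (norm (w k t))\<^sup>2) \<le> K\<^sup>2"
    and hold: "\<And>k s t. 0 \<le> s \<Longrightarrow> s < t \<Longrightarrow> t \<le> T \<Longrightarrow> (norm (Xh (h k) t - Xh (h k) s))\<^sup>2 \<le> (t - s) * K\<^sup>2"
    by metis
  have XhM: "norm (Xh (h k) t) \<le> M" if "t \<in> {0..T}" for k t
    unfolding Xh_def using that xM[OF hpos] by (intro norm_linear_interpolant_le[OF hpos]) auto
  have Xhc: "continuous_on {0..T} (Xh (h k))" for k
    using hN[of k] continuous_on_linear_interpolant[OF hpos] unfolding Xh_def by metis
  have equi: "\<exists>d. 0 < d \<and> (\<forall>n y. y \<in> {0..T} \<and> norm (t - y) < d \<longrightarrow> norm (Xh (h n) t - Xh (h n) y) < e)"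
    if t: "t \<in> {0..T}" and e: "0 < e" for t e
  proof (intro exI conjI allI impI)
    \<comment> \<open>The added 1 keeps the modulus e^2 / (K^2 + 1) meaningful when K = 0.\<close>
    have K1: "0 < K\<^sup>2 + 1" by (simp add: add_nonneg_pos)
    show "0 < e\<^sup>2 / (K\<^sup>2 + 1)" using e K1 by simp
    fix n y assume y: "y \<in> {0..T} \<and> norm (t - y) < e\<^sup>2 / (K\<^sup>2 + 1)"
    have "(norm (Xh (h n) t - Xh (h n) y))\<^sup>2 \<le> \<bar>t - y\<bar> * K\<^sup>2"
      using hold[of t y n] hold[of y t n] t y
      by (cases t y rule: linorder_cases) (auto simp: norm_minus_commute)
    also have "\<dots> \<le> \<bar>t - y\<bar> * (K\<^sup>2 + 1)" by (intro mult_left_mono) auto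
    also have "\<dots> < e\<^sup>2" using y K1 by (simp add: field_simps)
    finally show "norm (Xh (h n) t - Xh (h n) y) < e"
      using e by (simp add: power2_less_imp_less)
  qed
  obtain g r where g: "continuous_on {0..T} g" and r: "strict_mono (r :: nat \<Rightarrow> nat)"
    and gr: "\<And>e. 0 < e \<Longrightarrow> \<exists>N. \<forall>n t. n \<ge> N \<and> t \<in> {0..T} \<longrightarrow> norm (Xh (h (r n)) t - g t) < e"
    using Arzela_Ascoli[of "{0..T}" "\<lambda>n. Xh (h n)" M, OF compact_Icc XhM equi] by metis
  \<comment> \<open>Clamping the time extends the limit continuously to the whole line, avoiding
    one-sided arguments at the ends. For 0 < t < T the average reads \<open>X\<close> on [0,t]
    only.\<close>
  define X where "X t = g (max 0 (min T t))" for t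
  have Xc: "continuous_on UNIV X"
    unfolding X_def by (intro continuous_on_compose2[OF g] continuous_intros) (use \<open>0 < T\<close> in auto)
  have Xg: "X t = g t" if "t \<in> {0..T}" for t using that by (simp add: X_def)
  define \<eta> where "\<eta> k = h (r k)" for k
  have \<eta>pos: "0 < \<eta> k" for k using hpos by (simp add: \<eta>_def)
  have \<eta>lim: "\<eta> \<longlonglongrightarrow> 0"
    using LIMSEQ_subseq_LIMSEQ[OF \<open>h \<longlonglongrightarrow> 0\<close> r] by (simp add: \<eta>_def[abs_def] comp_def)
  have unif: "uniform_limit {0..T} (\<lambda>k. Xh (\<eta> k)) X sequentially"
    unfolding uniform_limit_iff eventually_sequentially dist_norm \<eta>_def
    using gr Xg by (metis (no_types, lifting))
  have XH1: "in_H1 0 T X"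
  proof (rule in_H1_uniform_limit)
    show "has_weak_deriv 0 T (Xh (\<eta> k)) (w (r k))" for k unfolding \<eta>_def by (rule w)
    show "(LINT t:{0<..<T}|lborel. (norm (w (r k) t))\<^sup>2) \<le> K\<^sup>2" for k by (rule w)
    show "uniform_limit {0<..<T} (\<lambda>k. Xh (\<eta> k)) X sequentially"
      by (rule uniform_limit_on_subset[OF unif]) auto
    show "in_Lp 2 {0<..<T} (Xh (\<eta> k))" for k
    proof -
      have "set_borel_measurable lborel {0<..<T} (Xh (\<eta> k))"
        using Xhc unfolding \<eta>_def by (intro set_borel_measurable_continuous_on continuous_on_subset[OF Xhc]) auto
      then have "Lp_convergent 2 {0<..<T} (\<lambda>_. Xh (\<eta> k)) (Xh (\<eta> k))"
        using XhM unfolding \<eta>_def by (intro Lp_convergent_bounded[where G = M]) auto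
      then show ?thesis unfolding Lp_convergent_def by blast
    qed
  qed

  \<comment> \<open>Convergence of the discrete averages, pointwise and in L^p\<close>
  define Z where "Z s = (if s < 0 then Xp s else X s)" for s
  have Zm: "Z \<in> borel_measurable borel"
  proof -
    have "(\<lambda>s. indicator {..<0} s *\<^sub>R Xp s) \<in> borel_measurable borel"
      by (intro borel_measurable_continuous_on_indicator lipschitz_on_continuous_on[OF L]) auto
    moreover have "X \<in> borel_measurable borel" using Xc by (rule borel_measurable_continuous_onI)
    ultimately have "(\<lambda>s. indicator {..<0} s *\<^sub>R Xp s + indicator {0..} s *\<^sub>R X s) \<in> borel_measurable borel"
      by measurable
    also have "(\<lambda>s. indicator {..<0} s *\<^sub>R Xp s + indicator {0..} s *\<^sub>R X s) = Z"
      by (auto simp: Z_def)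
    finally show ?thesis .
  qed
  have avg: "delayed_average \<rho> Xp X t = (LINT a:{0..}|lborel. \<rho> a *\<^sub>R Z (t - a))" for t
    by (simp add: delayed_average_def Z_def)
  \<comment> \<open>One intercept for both regimes: \<open>M\<close> covers indices \<ge> 0, the
    other two terms cover the linear growth of the past datum.\<close>
  define A where "A = M + norm (Xp (- 1)) + L"
  have bound: "norm (x \<beta> (n - int j)) \<le> A + L * (real j * \<beta>)" if "0 < \<beta>" "0 \<le> n" for \<beta> n j
  proof (cases "0 \<le> n - int j")
    case True
    have "norm (x \<beta> (n - int j)) \<le> M" using xM[OF that(1) True] .
    moreover have "0 \<le> L * (real j * \<beta>)" using L0 that by simp
    ultimately show ?thesis unfolding A_def using L0 by (smt (verit) norm_ge_zero)
  next
    case False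
    have neg: "of_int (n - int j) * \<beta> < 0" using False that by (simp add: mult_neg_pos)
    have "\<bar>of_int (n - int j) * \<beta>\<bar> \<le> real j * \<beta>"
      using False that by (auto simp: abs_mult intro!: mult_right_mono)
    then have "L * \<bar>of_int (n - int j) * \<beta>\<bar> \<le> L * (real j * \<beta>)" using L0 by (rule mult_left_mono)
    moreover have "norm (x \<beta> (n - int j)) \<le> norm (Xp (- 1)) + L + L * \<bar>of_int (n - int j) * \<beta>\<bar>"
      using lipschitz_linear_growth[OF L neg] False by (simp add: x_def sweeping_eq_past)
    ultimately show ?thesis unfolding A_def using \<open>0 < M\<close> by linarith
  qed
  \<comment> \<open>For s < 0 continuity of the past datum suffices; for 0 < s < T the times
    eventually stay in [0,T], where uniform convergence combines with continuity of
    \<open>X\<close>.\<close>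
  have grid: "(\<lambda>k. x (\<eta> k) (m k)) \<longlonglongrightarrow> Z s"
    if m: "(\<lambda>k. of_int (m k) * \<eta> k) \<longlonglongrightarrow> s" and s: "s \<noteq> 0" "s < T" for m s
  proof (cases "s < 0")
    case True
    have "continuous (at s) Xp"
      using lipschitz_on_continuous_on[OF L] True by (simp add: continuous_on_eq_continuous_at)
    then have "(\<lambda>k. Xp (of_int (m k) * \<eta> k)) \<longlonglongrightarrow> Xp s"
      using m by (rule isCont_tendsto_compose)
    moreover have "\<forall>\<^sub>F k in sequentially. Xp (of_int (m k) * \<eta> k) = x (\<eta> k) (m k)"
      using order_tendstoD(2)[OF m True]
    proof eventually_elim
      case (elim k)
      then have "m k < 0" using \<eta>pos[of k] by (simp add: mult_less_0_iff)
      then show ?case by (simp add: x_def sweeping_eq_past)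
    qed
    ultimately have "(\<lambda>k. x (\<eta> k) (m k)) \<longlonglongrightarrow> Xp s" by (rule Lim_transform_eventually)
    then show ?thesis using True by (simp add: Z_def)
  next
    case False
    then have "0 < s" using s by simp
    have ev: "\<forall>\<^sub>F k in sequentially. of_int (m k) * \<eta> k \<in> {0..T}"
      using order_tendstoD(1)[OF m \<open>0 < s\<close>] order_tendstoD(2)[OF m s(2)] by eventually_elim simp
    have "(\<lambda>k. Xh (\<eta> k) (of_int (m k) * \<eta> k) - X (of_int (m k) * \<eta> k)) \<longlonglongrightarrow> 0"
    proof (rule tendstoI)
      fix e :: real assume "0 < e"
      from uniform_limitD[OF unif this] ev
      show "\<forall>\<^sub>F k in sequentially. dist (Xh (\<eta> k) (of_int (m k) * \<eta> k) - X (of_int (m k) * \<eta> k)) 0 < e"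
        by eventually_elim (auto simp: dist_norm)
    qed
    moreover have "(\<lambda>k. X (of_int (m k) * \<eta> k)) \<longlonglongrightarrow> X s"
      using Xc m by (auto simp: continuous_on_eq_continuous_at intro: isCont_tendsto_compose)
    ultimately have "(\<lambda>k. Xh (\<eta> k) (of_int (m k) * \<eta> k)) \<longlonglongrightarrow> X s"
      using tendsto_add by fastforce
    moreover have "Xh (\<eta> k) (of_int (m k) * \<eta> k) = x (\<eta> k) (m k)" for k
      using \<eta>pos[of k] by (simp add: Xh_def linear_interpolant_def)
    ultimately show ?thesis using False by (simp add: Z_def)
  qed
  define n where "n t k = \<lceil>t / \<eta> k\<rceil> - 1" for t k
  have n0: "0 \<le> n t k" if "0 < t" for t k
  proof -
    have "0 < t / \<eta> k" using that \<eta>pos by simp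
    then have "0 < \<lceil>t / \<eta> k\<rceil>" by simp
    then show ?thesis by (simp add: n_def)
  qed
  have nlim: "(\<lambda>k. of_int (n t k) * \<eta> k) \<longlonglongrightarrow> t" for t
    unfolding n_def by (rule ceiling_step_tendsto[OF \<eta>lim \<eta>pos])
  have Xbar: "Xbarh (\<eta> k) t = discrete_average \<rho> (\<eta> k) (x (\<eta> k)) (n t k)" for k t
    by (simp add: Xbarh_def step_interpolant_def n_def)
  have Xbar_lim: "(\<lambda>k. Xbarh (\<eta> k) t) \<longlonglongrightarrow> delayed_average \<rho> Xp X t" if t: "t \<in> {0<..<T}" for t
    unfolding Xbar avg
  proof (rule discrete_average_tendsto[OF kernel \<eta>lim \<eta>pos L0 _ nlim Zm])
    show "norm (x (\<eta> k) (n t k - int j)) \<le> A + L * (real j * \<eta> k)" for k j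
      using t n0 by (intro bound \<eta>pos) auto
    show "(\<lambda>k. x (\<eta> k) (m k)) \<longlonglongrightarrow> Z s" if "s < t" "s \<noteq> 0" "(\<lambda>k. of_int (m k) * \<eta> k) \<longlonglongrightarrow> s" for s m
      using that t by (intro grid) auto
  qed
  have Lp: "Lp_convergent p {0<..<T} (\<lambda>k. Xbarh (\<eta> k)) (delayed_average \<rho> Xp X)" if p: "1 \<le> p" for p
  proof -
    have "(\<lambda>k. inverse (kernel_mass \<rho> (\<eta> k))) \<longlonglongrightarrow> inverse 1"
      by (intro tendsto_inverse kernel_mass_tendsto[OF kernel \<eta>lim \<eta>pos]) simp
    \<comment> \<open>Convergence of the normalizing factors bounds them for all k at once, so the
      averages have a uniform bound without discarding an initial segment of steps.\<close>
    then have "Bseq (\<lambda>k. inverse (kernel_mass \<rho> (\<eta> k)))"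
      by (intro convergent_imp_Bseq convergentI)
    then obtain G where G: "\<And>k. norm (inverse (kernel_mass \<rho> (\<eta> k))) \<le> G" by (auto simp: Bseq_def)
    have "norm (Xbarh (\<eta> k) t) \<le> G * \<bar>kernel_moment \<rho> A L\<bar>" if "t \<in> {0<..<T}" for k t
    proof -
      have "norm (Xbarh (\<eta> k) t) \<le> inverse (kernel_mass \<rho> (\<eta> k)) * kernel_moment \<rho> A L"
        unfolding Xbar using that n0 by (intro norm_discrete_average_le[OF kernel \<eta>pos L0] bound \<eta>pos) auto
      also have "\<dots> \<le> norm (inverse (kernel_mass \<rho> (\<eta> k))) * \<bar>kernel_moment \<rho> A L\<bar>"
        by (metis abs_ge_self abs_mult real_norm_def)
      also have "\<dots> \<le> G * \<bar>kernel_moment \<rho> A L\<bar>" by (intro mult_right_mono G) auto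
      finally show ?thesis .
    qed
    moreover have "set_borel_measurable lborel {0<..<T} (Xbarh (\<eta> k))" for k
    proof -
      have "(\<lambda>j. discrete_average \<rho> (\<eta> k) (x (\<eta> k)) (j - 1)) \<in> measurable (count_space UNIV) borel" by simp
      moreover have "(\<lambda>t. \<lceil>t / \<eta> k\<rceil>) \<in> measurable lborel (count_space UNIV)" by measurable
      ultimately have "Xbarh (\<eta> k) \<in> borel_measurable lborel"
        unfolding Xbarh_def step_interpolant_def by (rule measurable_compose[rotated])
      then show ?thesis unfolding set_borel_measurable_def by measurable
    qed
    ultimately show ?thesis using p Xbar_lim by (intro Lp_convergent_bounded) auto
  qed

  \<comment> \<open>Passage to the limit in the projection, at every interior time\<close>
  have proj: "delayed_average \<rho> Xp X t - X t \<in> normal_cone (C t) (X t)"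
      "X t = closest_point (C t) (delayed_average \<rho> Xp X t)" if t: "t \<in> {0<..<T}" for t
  proof -
    have nn: "0 \<le> of_int (n t k) * \<eta> k" for k using n0[of t k] t \<eta>pos[of k] by simp
    have xk: "x (\<eta> k) (n t k) = closest_point (C (of_int (n t k) * \<eta> k)) (Xbarh (\<eta> k) t)" for k
      unfolding x_def Xbar using n0 t by (intro sweeping_eq_closest_point) auto
    have "(\<lambda>k. x (\<eta> k) (n t k)) \<longlonglongrightarrow> Z t" using t by (intro grid nlim) auto
    then have p: "(\<lambda>k. closest_point (C (of_int (n t k) * \<eta> k)) (Xbarh (\<eta> k) t)) \<longlonglongrightarrow> X t"
      using t unfolding xk by (simp add: Z_def)
    \<comment> \<open>Hausdorff continuity is stated as a punctured limit; the value 0 at t itself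
      makes it continuity, which composes with the sequence of grid times.\<close>
    have self: "hausdorff_dist (C t) (C t) = 0"
      using Ccl[of t] t by (simp add: hausdorff_dist_def)
    have "continuous (at t within {0..}) (\<lambda>s. hausdorff_dist (C s) (C t))"
      using assms(8) t unfolding hausdorff_continuous_on_def continuous_within self by simp
    then have "(\<lambda>k. hausdorff_dist (C (of_int (n t k) * \<eta> k)) (C t)) \<longlonglongrightarrow> hausdorff_dist (C t) (C t)"
      using nlim nn by (auto simp: continuous_within_sequentially comp_def)
    then have "(\<lambda>k. hausdorff_dist (C (of_int (n t k) * \<eta> k)) (C t)) \<longlonglongrightarrow> 0"
      unfolding self .
    note lim = closest_point_limit[OF Ccl(1)[OF nn] Ccl(2)[OF nn] Ccl(3)[OF nn] Cbd[OF nn]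
        Ccl(1) Ccl(2) Ccl(3) Cbd this Xbar_lim[OF t] p]
    show "delayed_average \<rho> Xp X t - X t \<in> normal_cone (C t) (X t)" by (rule lim(1)) (use t in auto)
    show "X t = closest_point (C t) (delayed_average \<rho> Xp X t)" by (rule lim(2)) (use t in auto)
  qed
  show ?thesis
    using XH1 r unif[unfolded \<eta>_def] Lp[unfolded \<eta>_def] proj
    by (intro exI[of _ X] exI[of _ r] conjI allI impI AE_I2) auto
qed

end
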